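(* Let $\Sigma$ be either $\mathbb{C}$ or the open unit disk $\mathbb{D}$, and let $u:\Sigma\to\mathbb{R}$ be a harmonic function; assume $u$ is non-constant in case $\Sigma=\mathbb{D}$. Then there exists a complete conformal minimal immersion $Y=(Y_1,Y_2,Y_3):\Sigma\to\mathbb{R}^3$ such that $Y_3=u$.
   Context: A conformal minimal immersion is a conformal immersion with harmonic coordinate functions; it is complete if the metric it induces on $\Sigma$ is complete (every divergent curve has infinite induced length). *)

theory Defs
  imports "HOL-Analysis.Analysis"
begin

definition pdx :: "(complex \<Rightarrow> 'a::real_normed_vector) \<Rightarrow> complex \<Rightarrow> 'a" where
  "pdx f z = frechet_derivative f (at z) 1"

definition pdy :: "(complex \<Rightarrow> 'a::real_normed_vector) \<Rightarrow> complex \<Rightarrow> 'a" where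
  "pdy f z = frechet_derivative f (at z) \<i>"

definition C2_on :: "complex set \<Rightarrow> (complex \<Rightarrow> 'a::real_normed_vector) \<Rightarrow> bool" where
  "C2_on S f \<longleftrightarrow> open S \<and>
     (\<forall>z\<in>S. f differentiable at z \<and> pdx f differentiable at z \<and> pdy f differentiable at z) \<and>
     continuous_on S (pdx (pdx f)) \<and> continuous_on S (pdy (pdx f)) \<and>
     continuous_on S (pdx (pdy f)) \<and> continuous_on S (pdy (pdy f))"

definition harmonic_on :: "complex set \<Rightarrow> (complex \<Rightarrow> real) \<Rightarrow> bool" where
  "harmonic_on S u \<longleftrightarrow> C2_on S u \<and> (\<forall>z\<in>S. pdx (pdx u) z + pdy (pdy u) z = 0)"

definition conformal_immersion_on :: "complex set \<Rightarrow> (complex \<Rightarrow> real^3) \<Rightarrow> bool" where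
  "conformal_immersion_on S Y \<longleftrightarrow> open S \<and>
     (\<forall>z\<in>S. Y differentiable at z) \<and>
     continuous_on S (pdx Y) \<and> continuous_on S (pdy Y) \<and>
     (\<forall>z\<in>S. inj (frechet_derivative Y (at z))) \<and>
     (\<forall>z\<in>S. pdx Y z \<bullet> pdy Y z = 0 \<and> norm (pdx Y z) = norm (pdy Y z))"

definition conformal_minimal_immersion_on :: "complex set \<Rightarrow> (complex \<Rightarrow> real^3) \<Rightarrow> bool" where
  "conformal_minimal_immersion_on S Y \<longleftrightarrow>
     conformal_immersion_on S Y \<and> (\<forall>i. harmonic_on S (\<lambda>z. Y z $ i))"

definition curve_length :: "real set \<Rightarrow> (real \<Rightarrow> 'a::metric_space) \<Rightarrow> ereal" where
  "curve_length I c = (SUP p \<in> {(n::nat, t::nat \<Rightarrow> real). (\<forall>i\<le>n. t i \<in> I) \<and> (\<forall>i<n. t i \<le> t (Suc i))}.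
       ereal (\<Sum>i<fst p. dist (c (snd p i)) (c (snd p (Suc i)))))"

definition divergent_curve :: "complex set \<Rightarrow> (real \<Rightarrow> complex) \<Rightarrow> bool" where
  "divergent_curve S \<gamma> \<longleftrightarrow> continuous_on {0..<1} \<gamma> \<and> \<gamma> ` {0..<1} \<subseteq> S \<and>
     (\<forall>K. compact K \<and> K \<subseteq> S \<longrightarrow> (\<exists>t0\<in>{0..<1}. \<forall>t\<in>{t0..<1}. \<gamma> t \<notin> K))"

text \<open>Completeness of the induced metric: every divergent curve has infinite induced length
  (the induced length of \<gamma> is the Euclidean length of Y \<circ> \<gamma>).\<close>
definition complete_immersion_on :: "complex set \<Rightarrow> (complex \<Rightarrow> real^3) \<Rightarrow> bool" where
  "complete_immersion_on S Y \<longleftrightarrow>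
     (\<forall>\<gamma>. divergent_curve S \<gamma> \<longrightarrow> curve_length {0..<1} (Y \<circ> \<gamma>) = \<infinity>)"

end

theory Submission
  imports Defs "HOL-Complex_Analysis.Complex_Analysis"
    "HOL-Computational_Algebra.Fundamental_Theorem_Algebra"
begin

text \<open>
  Write \<open>u = Re h\<close> and \<open>f = h'\<close>. For any holomorphic \<open>H\<close>, put \<open>A = f\<^sup>2 exp (- H)\<close> and \<open>B = exp H\<close>; then
  \<open>((A - B) / 2, \<i> (A + B) / 2, f)\<close> is a nowhere vanishing null vector, so the real part of its
  primitive is a conformal minimal immersion with third coordinate \<open>u\<close>. Its conformal factor is
  \<open>(|A| + |B|) / 2\<close>, which dominates both \<open>|f|\<close> and \<open>exp (Re H) / 2\<close>. On the plane \<open>H = 0\<close> gives a complete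
  metric. On the disc, \<open>H\<close> is chosen as in the Jorge-Xavier labyrinth: in infinitely many annuli free of
  zeros of \<open>f\<close> one erects many thin C-shaped walls, with gaps alternately on the left and on the right,
  and makes \<open>Re H\<close> huge on all of them. A curve crossing such an annulus either penetrates a wall or is
  forced to zigzag between the gaps so often that the bound \<open>|f|\<close> from below makes its length at least 1.
  The required \<open>H\<close> is a limit of entire functions obtained by pole pushing as in Runge's theorem.
\<close>

section \<open>Approximation by entire functions\<close>

text \<open>The walls cannot be closed rings: by the minimum principle \<open>Re H\<close> would
  then be large on the whole disc that a ring encloses, and a new stage could not leave
  \<open>H\<close> almost unchanged further in. The gap keeps the complement of disc and wall
  connected, so that one entire function can be almost 0 on the disc and huge on the wall. The price
  is that curves slip through the gaps, and there the length must come from \<open>|f|\<close>.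
  Hence the annuli avoid the zeros of \<open>f\<close>, and a constant \<open>u\<close> is excluded
  on the disc: with \<open>f = 0\<close> the metric would be flat, and a complete flat simply
  connected surface is conformally the plane. The length gained per pair of walls depends on the
  minimum of \<open>|f|\<close> but not on the thickness of the walls, so an annulus of any width
  has room for enough of them.\<close>

definition entire_approx :: "complex set \<Rightarrow> (complex \<Rightarrow> complex) \<Rightarrow> bool" where
  "entire_approx K g \<longleftrightarrow>
     (\<forall>e>0. \<exists>P. P holomorphic_on UNIV \<and> (\<forall>z\<in>K. norm (P z - g z) < e))"

lemma entire_approx_holomorphic: "P holomorphic_on UNIV \<Longrightarrow> entire_approx K P"
  unfolding entire_approx_def by (auto intro!: exI[of _ P])

lemma entire_approx_cong:
  "(\<And>z. z \<in> K \<Longrightarrow> g z = h z) \<Longrightarrow> entire_approx K g \<longleftrightarrow> entire_approx K h"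
  unfolding entire_approx_def by simp

text \<open>A bound for an approximant within distance 1 passes to \<open>g\<close>; this is what
  controls products.\<close>

lemma entire_approx_bounded:
  assumes "compact K" "entire_approx K g"
  obtains B where "B > 0" "\<And>z. z \<in> K \<Longrightarrow> norm (g z) \<le> B"
proof -
  obtain P where P: "P holomorphic_on UNIV" "\<And>z. z \<in> K \<Longrightarrow> norm (P z - g z) < 1"
    using assms(2) unfolding entire_approx_def by (meson zero_less_one)
  have "compact (P ` K)"
    using P(1) assms(1) by (meson compact_continuous_image continuous_on_subset
        holomorphic_on_imp_continuous_on subset_UNIV)
  then obtain B where B: "B > 0" "\<And>z. z \<in> K \<Longrightarrow> norm (P z) \<le> B"
    by (metis bounded_pos compact_imp_bounded imageI)
  show thesis
  proof (rule that[of "B + 1"])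
    fix z assume "z \<in> K"
    then show "norm (g z) \<le> B + 1"
      using P(2)[of z] B(2)[of z] norm_triangle_ineq3[of "P z" "g z"] by linarith
  qed (use B in auto)
qed

lemma entire_approx_add:
  assumes "entire_approx K g" "entire_approx K h"
  shows "entire_approx K (\<lambda>z. g z + h z)"
  unfolding entire_approx_def
proof (intro allI impI)
  fix e :: real assume "e > 0"
  then have "e/2 > 0" by simp
  with assms obtain P Q
    where P: "P holomorphic_on UNIV" "\<And>z. z \<in> K \<Longrightarrow> norm (P z - g z) < e/2"
      and Q: "Q holomorphic_on UNIV" "\<And>z. z \<in> K \<Longrightarrow> norm (Q z - h z) < e/2"
    unfolding entire_approx_def by meson
  have "norm (P z + Q z - (g z + h z)) < e" if "z \<in> K" for z
  proof -
    have "P z + Q z - (g z + h z) = (P z - g z) + (Q z - h z)" by simp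
    then show ?thesis
      using P(2)[OF that] Q(2)[OF that] norm_triangle_ineq[of "P z - g z" "Q z - h z"]
      by (metis add_strict_mono field_sum_of_halves order_le_less_trans)
  qed
  then show "\<exists>P. P holomorphic_on UNIV \<and> (\<forall>z\<in>K. norm (P z - (g z + h z)) < e)"
    using P(1) Q(1) by (intro exI[of _ "\<lambda>z. P z + Q z"]) (auto intro: holomorphic_intros)
qed

lemma entire_approx_mult:
  assumes "compact K" "entire_approx K g" "entire_approx K h"
  shows "entire_approx K (\<lambda>z. g z * h z)"
  unfolding entire_approx_def
proof (intro allI impI)
  fix e :: real assume "e > 0"
  obtain B where B: "B > 0" "\<And>z. z \<in> K \<Longrightarrow> norm (h z) \<le> B"
    using entire_approx_bounded[OF assms(1,3)] by metis
  \<comment> \<open>The tolerances are chosen in turn: that of \<open>P\<close> against a bound for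
    \<open>h\<close>, that of \<open>Q\<close> against a bound for the \<open>P\<close> already
    chosen.\<close>
  have "e / (2 * B) > 0" using B \<open>e > 0\<close> by simp
  with assms(2) obtain P
    where P: "P holomorphic_on UNIV" "\<And>z. z \<in> K \<Longrightarrow> norm (P z - g z) < e / (2 * B)"
    unfolding entire_approx_def by meson
  obtain C where C: "C > 0" "\<And>z. z \<in> K \<Longrightarrow> norm (P z) \<le> C"
    using entire_approx_bounded[OF assms(1) entire_approx_holomorphic[OF P(1)]] by metis
  have "e / (2 * C) > 0" using C \<open>e > 0\<close> by simp
  with assms(3) obtain Q
    where Q: "Q holomorphic_on UNIV" "\<And>z. z \<in> K \<Longrightarrow> norm (Q z - h z) < e / (2 * C)"
    unfolding entire_approx_def by meson
  have "norm (P z * Q z - g z * h z) < e" if "z \<in> K" for z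
  proof -
    have "P z * Q z - g z * h z = P z * (Q z - h z) + (P z - g z) * h z"
      by (simp add: algebra_simps)
    then have "norm (P z * Q z - g z * h z)
        \<le> norm (P z) * norm (Q z - h z) + norm (P z - g z) * norm (h z)"
      by (metis norm_mult norm_triangle_ineq)
    also have "norm (P z) * norm (Q z - h z) \<le> C * norm (Q z - h z)"
      using C(2)[OF that] by (simp add: mult_right_mono)
    also have "C * norm (Q z - h z) < C * (e / (2 * C))"
      using C Q(2)[OF that] by (intro mult_strict_left_mono) auto
    also have "norm (P z - g z) * norm (h z) \<le> (e / (2 * B)) * B"
      using B P(2)[OF that] \<open>e > 0\<close> that by (intro mult_mono) (auto simp: less_imp_le)
    finally show ?thesis using B C by simp
  qed
  then show "\<exists>P. P holomorphic_on UNIV \<and> (\<forall>z\<in>K. norm (P z - g z * h z) < e)"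
    using P(1) Q(1) by (intro exI[of _ "\<lambda>z. P z * Q z"]) (auto intro: holomorphic_intros)
qed

lemma entire_approx_const: "entire_approx K (\<lambda>z. c)"
  by (rule entire_approx_holomorphic) simp

lemma entire_approx_power:
  assumes "compact K" "entire_approx K g"
  shows "entire_approx K (\<lambda>z. g z ^ n)"
  by (induction n) (use assms entire_approx_const entire_approx_mult in auto)

lemma entire_approx_sum:
  assumes "\<And>i. i \<in> I \<Longrightarrow> entire_approx K (g i)"
  shows "entire_approx K (\<lambda>z. \<Sum>i\<in>I. g i z)"
  using assms
  by (induction I rule: infinite_finite_induct)
     (auto simp: entire_approx_const intro: entire_approx_add)

lemma entire_approx_limit:
  assumes "\<And>e. e > 0 \<Longrightarrow> \<exists>g. entire_approx K g \<and> (\<forall>z\<in>K. norm (g z - h z) < e)"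
  shows "entire_approx K h"
  unfolding entire_approx_def
proof (intro allI impI)
  fix e :: real assume "e > 0"
  then obtain g where g: "entire_approx K g" "\<And>z. z \<in> K \<Longrightarrow> norm (g z - h z) < e/2"
    using assms[of "e/2"] by auto
  obtain P where P: "P holomorphic_on UNIV" "\<And>z. z \<in> K \<Longrightarrow> norm (P z - g z) < e/2"
    using g(1) \<open>e > 0\<close> unfolding entire_approx_def by (meson half_gt_zero)
  have "norm (P z - h z) < e" if "z \<in> K" for z
    using g(2)[OF that] P(2)[OF that] norm_triangle_ineq[of "P z - g z" "g z - h z"] by simp
  with P(1) show "\<exists>P. P holomorphic_on UNIV \<and> (\<forall>z\<in>K. norm (P z - h z) < e)" by blast
qed

text \<open>The partial sums of the geometric series are polynomials in \<open>x\<close>, and the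
  bound 1/2 makes their convergence uniform on \<open>K\<close>.\<close>

lemma entire_approx_inverse_one_minus:
  assumes "compact K" "entire_approx K x" "\<And>z. z \<in> K \<Longrightarrow> norm (x z) \<le> 1/2"
  shows "entire_approx K (\<lambda>z. inverse (1 - x z))"
proof (rule entire_approx_limit)
  fix e :: real assume "e > 0"
  then obtain n where n: "(1/2)^n < e/2"
    using real_arch_pow_inv[of "e/2" "1/2"] by auto
  have "norm ((\<Sum>k<n. x z ^ k) - inverse (1 - x z)) < e" if "z \<in> K" for z
  proof -
    have x: "norm (x z) \<le> 1/2" using assms(3) that by simp
    have ge: "norm (1 - x z) \<ge> 1/2"
      using x norm_triangle_ineq2[of 1 "x z"] by simp
    then have ne: "1 - x z \<noteq> 0" by auto
    then have "x z \<noteq> 1" by auto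
    then have "(\<Sum>k<n. x z ^ k) = (x z ^ n - 1) / (x z - 1)"
      using geometric_sum[of "x z" n] by simp
    also have "\<dots> - inverse (1 - x z) = - (x z ^ n) * inverse (1 - x z)"
      using ne \<open>x z \<noteq> 1\<close> by (simp add: divide_simps) (simp add: algebra_simps)
    finally have "norm ((\<Sum>k<n. x z ^ k) - inverse (1 - x z))
        = norm (x z) ^ n * inverse (norm (1 - x z))"
      by (simp add: norm_mult norm_power norm_inverse)
    also have "\<dots> \<le> (1/2)^n * 2"
    proof (intro mult_mono power_mono)
      show "inverse (norm (1 - x z)) \<le> 2"
        using ge le_imp_inverse_le[OF ge] by simp
    qed (use x in auto)
    finally show ?thesis using n by simp
  qed
  moreover have "entire_approx K (\<lambda>z. \<Sum>k<n. x z ^ k)"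
    by (intro entire_approx_sum entire_approx_power assms)
  ultimately show "\<exists>g. entire_approx K g \<and> (\<forall>z\<in>K. norm (g z - inverse (1 - x z)) < e)"
    by blast
qed

section \<open>Moving poles outside a compact set\<close>

text \<open>Geometric series in \<open>z / a\<close>, whose modulus is at most 1/2 on
  \<open>K\<close>. Such a remote pole is the starting point from which all others are
  reached.\<close>

lemma entire_approx_pole_far:
  assumes "compact K" "\<And>z. z \<in> K \<Longrightarrow> 2 * norm z \<le> norm a" "a \<noteq> 0"
  shows "entire_approx K (\<lambda>z. inverse (z - a))"
proof -
  have "entire_approx K (\<lambda>z. z / a)"
    by (rule entire_approx_holomorphic) (use assms in \<open>auto intro!: holomorphic_intros\<close>)
  then have "entire_approx K (\<lambda>z. inverse (1 - z / a))"
    using assms by (intro entire_approx_inverse_one_minus)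
      (auto simp: norm_divide divide_simps mult.commute)
  then have "entire_approx K (\<lambda>z. (- inverse a) * inverse (1 - z / a))"
    by (intro entire_approx_mult assms entire_approx_const)
  moreover have "(- inverse a) * inverse (1 - z / a) = inverse (z - a)" for z
  proof -
    have "inverse (z - a) = inverse ((- a) * (1 - z / a))"
      using assms(3) by (simp add: algebra_simps)
    then show ?thesis by (simp add: inverse_mult_distrib)
  qed
  ultimately show ?thesis by simp
qed

text \<open>Re-expansion about the old pole: \<open>1 / (z - b)\<close> is
  \<open>1 / (z - a)\<close> times the sum of a geometric series with ratio
  \<open>(b - a) / (z - a)\<close>.\<close>

lemma entire_approx_pole_push:
  assumes "compact K" "entire_approx K (\<lambda>z. inverse (z - a))" "a \<notin> K"
    and "\<And>z. z \<in> K \<Longrightarrow> 2 * norm (b - a) \<le> norm (z - a)"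
  shows "entire_approx K (\<lambda>z. inverse (z - b))"
proof -
  have "entire_approx K (\<lambda>z. (b - a) * inverse (z - a))"
    by (intro entire_approx_mult assms entire_approx_const)
  then have "entire_approx K (\<lambda>z. inverse (1 - (b - a) * inverse (z - a)))"
  proof (rule entire_approx_inverse_one_minus[OF assms(1)])
    fix z assume z: "z \<in> K"
    then have "z \<noteq> a" using assms by auto
    then show "norm ((b - a) * inverse (z - a)) \<le> 1/2"
      using assms(4)[OF z] by (simp add: norm_mult norm_inverse) (simp add: divide_simps norm_divide mult.commute)
  qed
  then have "entire_approx K (\<lambda>z. inverse (z - a) * inverse (1 - (b - a) * inverse (z - a)))"
    by (intro entire_approx_mult assms)
  moreover have "inverse (z - a) * inverse (1 - (b - a) * inverse (z - a)) = inverse (z - b)"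
    if "z \<in> K" for z
  proof -
    have "z - a \<noteq> 0" using that assms by auto
    then have "z - b = (z - a) * (1 - (b - a) * inverse (z - a))"
      by (simp add: field_simps)
    then show ?thesis by (metis inverse_mult_distrib)
  qed
  ultimately show ?thesis using entire_approx_cong by (metis (no_types, lifting))
qed

text \<open>Whether a pole can be approximated is locally constant in its position off
  \<open>K\<close>, hence constant along connected sets that miss \<open>K\<close>.\<close>

lemma entire_approx_pole_connected:
  assumes "compact K" "connected T" "T \<inter> K = {}" "a \<in> T" "b \<in> T"
    and "entire_approx K (\<lambda>z. inverse (z - a))"
  shows "entire_approx K (\<lambda>z. inverse (z - b))"
proof -
  have "entire_approx K (\<lambda>z. inverse (z - a)) = entire_approx K (\<lambda>z. inverse (z - b))"
  proof (rule connected_equivalence_relation[OF assms(2,4,5)])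
    fix c assume c: "c \<in> T"
    then have "c \<notin> K" using assms by auto
    obtain d where d: "d > 0" "\<And>z. z \<in> K \<Longrightarrow> d \<le> dist c z"
      using separate_point_closed[OF compact_imp_closed[OF assms(1)] \<open>c \<notin> K\<close>] by metis
    show "\<exists>U. openin (top_of_set T) U \<and> c \<in> U \<and>
        (\<forall>x\<in>U. entire_approx K (\<lambda>z. inverse (z - c)) = entire_approx K (\<lambda>z. inverse (z - x)))"
    proof (intro exI[of _ "T \<inter> ball c (d/3)"] conjI ballI)
      \<comment> \<open>The radius \<open>d/3\<close> lets the push go both ways: \<open>x\<close>
        still has distance more than \<open>2 * d / 3\<close> from \<open>K\<close>.\<close>
      fix x assume x: "x \<in> T \<inter> ball c (d/3)"
      have 1: "2 * norm (x - c) \<le> norm (z - c)" "2 * norm (c - x) \<le> norm (z - x)" if "z \<in> K" for z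
      proof -
        have "dist c x < d/3" "d \<le> dist c z" "0 \<le> dist c x" using x d(2)[OF that] by auto
        moreover have "dist c z \<le> dist c x + dist x z" by (rule dist_triangle)
        ultimately have "2 * dist c x \<le> dist c z" "2 * dist c x \<le> dist x z" by linarith+
        then show "2 * norm (x - c) \<le> norm (z - c)" "2 * norm (c - x) \<le> norm (z - x)"
          by (simp_all add: dist_norm norm_minus_commute)
      qed
      have "x \<notin> K" using x assms by auto
      show "entire_approx K (\<lambda>z. inverse (z - c)) = entire_approx K (\<lambda>z. inverse (z - x))"
        using entire_approx_pole_push[OF assms(1) _ \<open>c \<notin> K\<close> 1(1)]
              entire_approx_pole_push[OF assms(1) _ \<open>x \<notin> K\<close> 1(2)] by blast
    qed (use c d in \<open>auto simp: openin_open_Int\<close>)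
  qed auto
  with assms show ?thesis by simp
qed

text \<open>Splitting \<open>p\<close> into linear factors makes \<open>1 / p\<close> a product of
  simple poles, repeated according to multiplicity.\<close>

lemma entire_approx_inverse_poly:
  assumes "compact K" "p \<noteq> 0"
    and "\<And>a. poly p a = 0 \<Longrightarrow> entire_approx K (\<lambda>z. inverse (z - a))"
  shows "entire_approx K (\<lambda>z. inverse (poly p z))"
proof -
  obtain A where A: "p = smult (lead_coeff p) (\<Prod>x\<in>#A. [:-x, 1:])"
    using alg_closed_imp_factorization[OF assms(2)] by metis
  have "poly p a = 0" if "a \<in># A" for a
  proof -
    have "poly (\<Prod>x\<in>#A. [:-x, 1:]) a = 0"
      using that by (auto simp: poly_prod_mset image_iff)
    then show ?thesis by (subst A) simp
  qed
  then have "entire_approx K (\<lambda>z. inverse (z - a))" if "a \<in># A" for a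
    using assms(3) that by blast
  then have "entire_approx K (\<lambda>z. inverse (poly (\<Prod>x\<in>#A. [:-x, 1:]) z))"
  proof (induction A)
    case empty
    then show ?case by (simp add: entire_approx_const)
  next
    case (add x A)
    have "entire_approx K (\<lambda>z. inverse (z - x) * inverse (poly (\<Prod>x\<in>#A. [:-x, 1:]) z))"
      using add by (intro entire_approx_mult assms(1)) auto
    moreover have "poly (\<Prod>y\<in>#add_mset x A. [:-y, 1:]) z = (z - x) * poly (\<Prod>y\<in>#A. [:-y, 1:]) z" for z
      by (simp add: algebra_simps)
    ultimately show ?case by (simp only: inverse_mult_distrib)
  qed
  then have "entire_approx K (\<lambda>z. inverse (lead_coeff p) * inverse (poly (\<Prod>x\<in>#A. [:-x, 1:]) z))"
    by (intro entire_approx_mult assms(1) entire_approx_const)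
  moreover have "inverse (poly p z) = inverse (lead_coeff p) * inverse (poly (\<Prod>x\<in>#A. [:-x, 1:]) z)" for z
    by (subst A) (simp add: inverse_mult_distrib)
  ultimately show ?thesis by simp
qed

section \<open>Functions with large real part on walls\<close>

text \<open>\<open>\<sigma> = 1\<close> opens the annulus on the left, \<open>\<sigma> = -1\<close>
  on the right. The offset 1/8 puts the gaps of opposite walls 1/4 apart; the radii in use exceed
  1/2, so the gap is a real opening.\<close>

definition wall :: "real \<Rightarrow> real \<Rightarrow> real \<Rightarrow> complex set" where
  "wall \<sigma> r s = {z. r \<le> norm z \<and> norm z \<le> s \<and> \<sigma> * Re z \<ge> - 1/8}"

lemma compact_wall: "compact (wall \<sigma> r s)"
proof -
  have "wall \<sigma> r s = cball 0 s \<inter> ({z. r \<le> norm z} \<inter> {z. \<sigma> * Re z \<ge> - 1/8})"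
    by (auto simp: wall_def)
  moreover have "closed ({z. r \<le> norm z} \<inter> {z::complex. \<sigma> * Re z \<ge> - 1/8})"
    by (intro closed_Int closed_Collect_le continuous_intros)
  ultimately show ?thesis by (simp add: compact_Int_closed)
qed

text \<open>Serves on both sides of a circle: with \<open>x = z / \<rho>\<close> on the disc and
  with \<open>x = \<rho> / z\<close> on the wall.\<close>

lemma inverse_one_plus_power_small:
  fixes x :: complex
  assumes "norm x \<le> q" "q < 1" "q ^ m \<le> 1/2"
  shows "norm (1 - inverse (1 + x ^ m)) \<le> 2 * q ^ m"
proof -
  have x: "norm (x ^ m) \<le> q ^ m" using assms by (simp add: norm_power power_mono)
  then have ge: "norm (1 + x ^ m) \<ge> 1/2"
    using assms norm_triangle_ineq2[of 1 "- (x ^ m)"] by simp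
  then have "1 + x ^ m \<noteq> 0" by auto
  then have "1 - inverse (1 + x ^ m) = x ^ m * inverse (1 + x ^ m)"
    by (simp add: divide_simps)
  then have "norm (1 - inverse (1 + x ^ m)) = norm (x ^ m) * inverse (norm (1 + x ^ m))"
    by (simp add: norm_mult norm_inverse)
  also have "\<dots> \<le> q ^ m * 2"
    using x ge le_imp_inverse_le[OF ge] order_trans[OF norm_ge_zero x] by (intro mult_mono) auto
  finally show ?thesis by simp
qed

text \<open>
  The function \<open>1 - 1 / (1 + (z / \<rho>)\<^sup>m)\<close> is close to 0 inside and close to 1 outside the circle of radius
  \<open>\<rho>\<close>, which separates the disc from the wall. Its poles lie on that circle, and they can be pushed along
  the circle and then through the gap of the wall, along the negative real axis, to infinity.
\<close>
lemma wall_function_right: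
  assumes "1/8 < b" "b < r" "e > 0"
  obtains Q where "Q holomorphic_on UNIV" "\<And>z. norm z \<le> b \<Longrightarrow> norm (Q z) \<le> e"
    "\<And>z. z \<in> wall 1 r s \<Longrightarrow> Re (Q z) \<ge> M"
proof -
  define K where "K = cball 0 b \<union> wall 1 r s"
  have K: "compact K" by (simp add: K_def compact_Un compact_wall)
  define \<rho> where "\<rho> = (b + r) / 2"
  have \<rho>: "b < \<rho>" "\<rho> < r" using assms by (auto simp: \<rho>_def)
  \<comment> \<open>This ray runs through the gap since \<open>b > 1/8\<close>, and it meets the
    circle of radius \<open>\<rho>\<close> in its leftmost point.\<close>
  define T where "T = (\<lambda>x. - complex_of_real x) ` {b<..}"
  have T: "connected T" unfolding T_def
    by (intro connected_continuous_image continuous_intros) simp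
  have "T \<inter> K = {}"
    using assms by (auto simp: T_def K_def wall_def norm_minus_cancel)
  \<comment> \<open>The first pole: a point of the ray whose modulus is more than twice that of any
    point of \<open>K\<close>.\<close>
  define R where "R = 2 * max (\<bar>b\<bar>) (\<bar>s\<bar>) + 1"
  have "entire_approx K (\<lambda>z. inverse (z - (- complex_of_real R)))"
  proof (rule entire_approx_pole_far[OF K])
    have "R > 0" by (simp add: R_def)
    then have R: "norm (- complex_of_real R) = R" by simp
    show "- complex_of_real R \<noteq> 0" using \<open>R > 0\<close> by simp
    show "2 * norm z \<le> norm (- complex_of_real R)" if "z \<in> K" for z
      unfolding R using that by (auto simp: K_def wall_def R_def)
  qed
  moreover have "- complex_of_real R \<in> T" "- complex_of_real \<rho> \<in> T"
    using \<rho> unfolding T_def by (auto simp: R_def intro!: imageI simp del: of_real_add)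
  ultimately have "entire_approx K (\<lambda>z. inverse (z - (- complex_of_real \<rho>)))"
    using entire_approx_pole_connected[OF K T \<open>T \<inter> K = {}\<close>] by metis
  moreover have "sphere 0 \<rho> \<inter> K = {}" using \<rho> by (auto simp: K_def wall_def)
  moreover have "- complex_of_real \<rho> \<in> sphere 0 \<rho>" using \<rho> assms by simp
  moreover have "connected (sphere (0::complex) \<rho>)" by (rule connected_sphere) simp
  ultimately have pole: "entire_approx K (\<lambda>z. inverse (z - a))" if "norm a = \<rho>" for a
    using entire_approx_pole_connected[OF K, of "sphere 0 \<rho>" "- complex_of_real \<rho>" a] that by simp
  \<comment> \<open>One ratio below 1 for both regions: it bounds \<open>|z / \<rho>|\<close> on the
    disc and \<open>|\<rho> / z|\<close> on the wall.\<close>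
  define q where "q = max (b / \<rho>) (\<rho> / r)"
  have q: "0 < q" "q < 1" using \<rho> assms by (auto simp: q_def less_max_iff_disj)
  \<comment> \<open>The height aimed at on the wall. It survives a total error \<open>e\<close>,
    since \<open>M' - e \<ge> M\<close>, and \<open>M' \<ge> 2 * e\<close> makes the bound chosen
    below for \<open>q ^ m\<close> at most 1/8.\<close>
  define M' where "M' = 2 * (\<bar>M\<bar> + e)"
  have M': "M' > 0" "M' \<ge> 2 * e" using assms by (auto simp: M'_def)
  obtain m where m: "q ^ m < e / (4 * M')"
    using real_arch_pow_inv[of "e / (4 * M')" q] q M' assms by auto
  have "e / (4 * M') \<le> 1/8" using M' assms by (simp add: divide_simps)
  with m have mq: "q ^ m \<le> 1/8" by simp
  then have "m > 0" by (cases m) auto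
  \<comment> \<open>This is \<open>1 + (z / \<rho>) ^ m\<close>; its roots solve
    \<open>z ^ m = - (\<rho> ^ m)\<close> and so all lie on the circle.\<close>
  define p where "p = [:1:] + monom (inverse (complex_of_real \<rho>) ^ m) m"
  have pz: "poly p z = 1 + (z / \<rho>) ^ m" for z
    by (simp add: p_def poly_monom field_simps power_divide)
  have "poly p 0 \<noteq> 0" using \<open>m > 0\<close> by (simp add: pz power_0_left)
  then have "p \<noteq> 0" by auto
  have root: "norm a = \<rho>" if "poly p a = 0" for a
  proof -
    have "(a / \<rho>) ^ m = - 1" using that by (simp add: pz add_eq_0_iff)
    then have "norm (a / \<rho>) ^ m = 1" by (metis norm_minus_cancel norm_one norm_power)
    then have "norm (a / \<rho>) = 1"
      using \<open>m > 0\<close> power_eq_imp_eq_base[of "norm (a / \<rho>)" m 1] by simp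
    then show ?thesis using \<rho> assms by (simp add: norm_divide divide_simps split: if_splits)
  qed
  have ap: "entire_approx K (\<lambda>z. inverse (poly p z))"
    by (rule entire_approx_inverse_poly[OF K \<open>p \<noteq> 0\<close>]) (use root pole in auto)
  have "entire_approx K (\<lambda>z. M' + (- M') * inverse (poly p z))"
    by (intro entire_approx_add entire_approx_const entire_approx_mult[OF K] ap)
  then obtain Q where Q: "Q holomorphic_on UNIV"
      "\<And>z. z \<in> K \<Longrightarrow> norm (Q z - (M' + (- M') * inverse (poly p z))) < e/2"
    using \<open>e > 0\<close> unfolding entire_approx_def by (meson half_gt_zero)
  have M'm: "M' * (2 * q ^ m) \<le> e/2" using m M' by (simp add: field_simps)
  show thesis
  proof (rule that[OF Q(1)])
    fix z :: complex assume z: "norm z \<le> b"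
    have "norm (z / \<rho>) \<le> q" using z \<rho> assms by (simp add: norm_divide q_def le_max_iff_disj divide_right_mono)
    then have "norm (1 - inverse (poly p z)) \<le> 2 * q ^ m"
      unfolding pz using q mq by (intro inverse_one_plus_power_small) auto
    then have "M' * norm (1 - inverse (poly p z)) \<le> M' * (2 * q ^ m)"
      using M' by (intro mult_left_mono) auto
    moreover have "norm (M' + (- M') * inverse (poly p z)) = M' * norm (1 - inverse (poly p z))"
    proof -
      have "M' + (- M') * inverse (poly p z) = M' * (1 - inverse (poly p z))"
        by (simp add: algebra_simps)
      then show ?thesis using M' by (simp add: norm_mult)
    qed
    ultimately have "norm (M' + (- M') * inverse (poly p z)) \<le> e/2" using M'm by linarith
    moreover have "norm (Q z - (M' + (- M') * inverse (poly p z))) < e/2"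
      using z by (intro Q) (simp add: K_def)
    ultimately show "norm (Q z) \<le> e"
      using norm_triangle_ineq2[of "Q z" "M' + (- M') * inverse (poly p z)"] by linarith
  next
    fix z assume z: "z \<in> wall 1 r s"
    then have nz: "norm z \<ge> r" by (simp add: wall_def)
    then have z0: "z \<noteq> 0" using assms by auto
    have "\<rho> / norm z \<le> \<rho> / r" using nz \<rho> assms by (intro divide_left_mono mult_pos_pos) auto
    then have "norm (\<rho> / z) \<le> q" using \<rho> assms by (simp add: norm_divide q_def le_max_iff_disj)
    then have small: "norm (1 - inverse (1 + (\<rho> / z) ^ m)) \<le> 2 * q ^ m"
      using q mq by (intro inverse_one_plus_power_small) auto
    \<comment> \<open>With \<open>w = (z / \<rho>) ^ m\<close>, replacing \<open>w\<close> by
      \<open>1 / w\<close> turns \<open>1 - 1 / (1 + w)\<close> into \<open>1 / (1 + w)\<close>, so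
      the estimate for small arguments also serves for large ones.\<close>
    have "1 - inverse (1 + (\<rho> / z) ^ m) = inverse (poly p z)"
    proof -
      have "norm z \<noteq> \<rho>" using nz \<rho> by auto
      then have ne: "poly p z \<noteq> 0" using root by blast
      define w where "w = (z / \<rho>) ^ m"
      have w: "w \<noteq> 0" "1 + w \<noteq> 0" using z0 \<rho> assms ne by (auto simp: w_def pz)
      have "(\<rho> / z) ^ m = inverse w" by (simp add: w_def power_divide)
      moreover have "1 - inverse (1 + inverse w) = inverse (1 + w)"
        using w by (simp add: divide_simps) (simp add: add.commute)
      ultimately show ?thesis by (simp add: pz w_def)
    qed
    with small have "norm (inverse (poly p z)) \<le> 2 * q ^ m" by simp
    then have "M' * norm (inverse (poly p z)) \<le> M' * (2 * q ^ m)"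
      using M' by (intro mult_left_mono) auto
    then have "norm (M' * inverse (poly p z)) \<le> e/2"
      using M'm M' by (simp only: norm_mult norm_of_real)
    moreover have "norm (Q z - (M' + (- M') * inverse (poly p z))) < e/2"
      using z by (intro Q) (simp add: K_def)
    moreover have "\<bar>Re (M' * inverse (poly p z))\<bar> \<le> norm (M' * inverse (poly p z))"
      "\<bar>Re (Q z - (M' + (- M') * inverse (poly p z)))\<bar> \<le> norm (Q z - (M' + (- M') * inverse (poly p z)))"
      by (rule abs_Re_le_cmod)+
    moreover have "Re (Q z - (M' + (- M') * inverse (poly p z))) = Re (Q z) - M' + Re (M' * inverse (poly p z))"
      by simp
    ultimately have "Re (Q z) \<ge> M' - e" by linarith
    then show "Re (Q z) \<ge> M" using assms by (simp add: M'_def)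
  qed
qed

text \<open>The half turn \<open>z \<mapsto> - z\<close> exchanges the two kinds of wall and
  preserves discs about 0.\<close>

lemma wall_function:
  assumes "\<sigma> = 1 \<or> \<sigma> = -1" "1/8 < b" "b < r" "e > 0"
  obtains Q where "Q holomorphic_on UNIV" "\<And>z. norm z \<le> b \<Longrightarrow> norm (Q z) \<le> e"
    "\<And>z. z \<in> wall \<sigma> r s \<Longrightarrow> Re (Q z) \<ge> M"
proof -
  obtain Q where Q: "Q holomorphic_on UNIV" "\<And>z. norm z \<le> b \<Longrightarrow> norm (Q z) \<le> e"
    "\<And>z. z \<in> wall 1 r s \<Longrightarrow> Re (Q z) \<ge> M"
    using wall_function_right[OF assms(2-4)] by metis
  show thesis
  proof (rule that[of "\<lambda>z. Q (\<sigma> * z)"])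
    have "(Q \<circ> (\<lambda>z. \<sigma> * z)) holomorphic_on UNIV"
      by (intro holomorphic_on_compose_gen[of _ _ _ UNIV] Q(1) holomorphic_intros) auto
    then show "(\<lambda>z. Q (\<sigma> * z)) holomorphic_on UNIV" by (simp add: o_def)
  qed (use assms(1) Q in \<open>auto simp: wall_def\<close>)
qed

section \<open>Superposing walls and stages\<close>

lemma holomorphic_bounded_cball:
  assumes "H holomorphic_on UNIV"
  obtains B where "B \<ge> 0" "\<And>z. norm z \<le> r \<Longrightarrow> norm (H z) \<le> B"
  using entire_approx_bounded[OF compact_cball[of 0 r] entire_approx_holomorphic[OF assms]]
  by (metis less_imp_le mem_cball_0)

text \<open>Walls are added from the inside outwards. The function for a new wall is tiny on the
  disc that contains all earlier walls, so it spoils them by at most 1; on its own wall it must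
  outweigh whatever the earlier functions do there.\<close>

lemma finite_walls_function:
  fixes b r s :: "nat \<Rightarrow> real" and \<sigma> :: "nat \<Rightarrow> real"
  assumes "\<And>j. \<sigma> j = 1 \<or> \<sigma> j = -1" "1/8 < b 0"
    "\<And>j. b j < r j" "\<And>j. r j \<le> s j" "\<And>j. s j \<le> b (Suc j)" "e > 0"
  shows "\<exists>P. P holomorphic_on UNIV \<and> (\<forall>z. norm z \<le> b 0 \<longrightarrow> norm (P z) \<le> e) \<and>
    (\<forall>j<k. \<forall>z\<in>wall (\<sigma> j) (r j) (s j). Re (P z) \<ge> M)"
  using \<open>e > 0\<close>
proof (induction k arbitrary: e M)
  case 0
  then show ?case by (intro exI[of _ "\<lambda>_. 0"]) auto
next
  case (Suc k)
  have step: "b j \<le> b (Suc j)" for j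
    using assms(3)[of j] assms(4)[of j] assms(5)[of j] by linarith
  then have mono: "i \<le> j \<Longrightarrow> b i \<le> b j" for i j by (rule lift_Suc_mono_le)
  have "e/2 > 0" using Suc.prems by simp
  \<comment> \<open>One unit of height is reserved for the damage done by the next function, and
    half of \<open>e\<close> for its size on the innermost disc.\<close>
  from Suc.IH[OF this, of "M + 1"] obtain P where P: "P holomorphic_on UNIV"
      "\<And>z. norm z \<le> b 0 \<Longrightarrow> norm (P z) \<le> e/2"
      "\<And>j z. j < k \<Longrightarrow> z \<in> wall (\<sigma> j) (r j) (s j) \<Longrightarrow> Re (P z) \<ge> M + 1" by metis
  obtain B where B: "\<And>z. norm z \<le> s k \<Longrightarrow> norm (P z) \<le> B"
    using holomorphic_bounded_cball[OF P(1)] by metis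
  have "1/8 < b k" using assms(2) mono[of 0 k] by simp
  moreover have "min (e/2) 1 > 0" using Suc.prems by simp
  ultimately obtain Q where Q: "Q holomorphic_on UNIV"
      "\<And>z. norm z \<le> b k \<Longrightarrow> norm (Q z) \<le> min (e/2) 1"
      "\<And>z. z \<in> wall (\<sigma> k) (r k) (s k) \<Longrightarrow> Re (Q z) \<ge> M + B"
    using wall_function[OF assms(1)[of k] _ assms(3)[of k]] by metis
  show ?case
  proof (intro exI[of _ "\<lambda>z. P z + Q z"] conjI allI impI ballI)
    show "(\<lambda>z. P z + Q z) holomorphic_on UNIV" by (intro holomorphic_intros P Q)
  next
    fix z :: complex assume "norm z \<le> b 0"
    then show "norm (P z + Q z) \<le> e"
      using P(2)[of z] Q(2)[of z] mono[of 0 k] norm_triangle_ineq[of "P z" "Q z"] by simp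
  next
    fix j z assume j: "j < Suc k" and z: "z \<in> wall (\<sigma> j) (r j) (s j)"
    show "M \<le> Re (P z + Q z)"
    proof (cases "j = k")
      case True
      then have "norm (P z) \<le> B" using z by (intro B) (simp add: wall_def)
      then show ?thesis using Q(3)[of z] z True abs_Re_le_cmod[of "P z"] by simp
    next
      case False
      then have "j < k" using j by simp
      have "norm z \<le> b (Suc j)" using z assms(5)[of j] by (simp add: wall_def)
      also have "\<dots> \<le> b k" using \<open>j < k\<close> by (intro mono) simp
      finally have "norm (Q z) \<le> 1" using Q(2) by simp
      then show ?thesis using P(3)[OF \<open>j < k\<close> z] abs_Re_le_cmod[of "Q z"] by simp
    qed
  qed
qed

text \<open>A telescoping limit in the manner of Mittag-Leffler: stage \<open>n\<close> changes the
  function by at most \<open>(1/2)^n\<close> on the disc of radius \<open>s n\<close>, so the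
  changes sum up locally uniformly on the unit disc although each may be enormous further
  out.\<close>

lemma labyrinth_function:
  fixes s t C :: "nat \<Rightarrow> real" and W :: "nat \<Rightarrow> complex set"
  assumes st: "\<And>n. s n \<le> t n" "\<And>n. t n \<le> s (Suc n)" "\<And>n. s n < 1" "s \<longlonglongrightarrow> 1"
    and W: "\<And>n. W n \<subseteq> cball 0 (t n)"
    and fn: "\<And>n e M. e > 0 \<Longrightarrow> \<exists>P. P holomorphic_on UNIV \<and>
        (\<forall>z. norm z \<le> s n \<longrightarrow> norm (P z) \<le> e) \<and> (\<forall>z\<in>W n. Re (P z) \<ge> M)"
  obtains H where "H holomorphic_on ball 0 1" "\<And>n z. z \<in> W n \<Longrightarrow> Re (H z) \<ge> C n"
proof -
  have "\<exists>h. \<forall>n. (h n holomorphic_on UNIV) \<and>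
    (\<forall>z. norm z \<le> s n \<longrightarrow> norm (h (Suc n) z - h n z) \<le> (1/2)^n) \<and>
    (\<forall>z\<in>W n. Re (h (Suc n) z) \<ge> C n + 1)"
  proof -
    have "\<exists>h. \<forall>n. (h n holomorphic_on UNIV) \<and>
      ((\<forall>z. norm z \<le> s n \<longrightarrow> norm (h (Suc n) z - h n z) \<le> (1/2)^n) \<and>
      (\<forall>z\<in>W n. Re (h (Suc n) z) \<ge> C n + 1))"
    proof (rule dependent_nat_choice)
      show "\<exists>h. h holomorphic_on (UNIV :: complex set)" by (intro exI[of _ "\<lambda>_. 0"]) simp
    next
      fix h :: "complex \<Rightarrow> complex" and n assume h: "h holomorphic_on UNIV"
      obtain B where B: "\<And>z. norm z \<le> t n \<Longrightarrow> norm (h z) \<le> B"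
        using holomorphic_bounded_cball[OF h] by metis
      have "(0::real) < (1/2)^n" by simp
      \<comment> \<open>\<open>B\<close> outweighs the function built so far on the new walls, and
        the extra 1 pays for all later changes.\<close>
      from fn[OF this, of n "C n + 1 + B"] obtain P where P: "P holomorphic_on UNIV"
        "\<And>z. norm z \<le> s n \<Longrightarrow> norm (P z) \<le> (1/2)^n" "\<And>z. z \<in> W n \<Longrightarrow> Re (P z) \<ge> C n + 1 + B"
        by metis
      show "\<exists>y. y holomorphic_on UNIV \<and>
            ((\<forall>z. norm z \<le> s n \<longrightarrow> norm (y z - h z) \<le> (1/2)^n) \<and>
            (\<forall>z\<in>W n. Re (y z) \<ge> C n + 1))"
      proof (intro exI[of _ "\<lambda>z. h z + P z"] conjI allI impI ballI)
        fix z assume z: "z \<in> W n"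
        then have "norm (h z) \<le> B" using W B by (simp add: subset_iff)
        then show "C n + 1 \<le> Re (h z + P z)" using P(3)[OF z] abs_Re_le_cmod[of "h z"] by simp
      qed (use P h in \<open>auto intro: holomorphic_intros\<close>)
    qed
    then show ?thesis by auto
  qed
  then obtain h where h: "\<And>n. h n holomorphic_on UNIV"
      "\<And>n z. norm z \<le> s n \<Longrightarrow> norm (h (Suc n) z - h n z) \<le> (1/2)^n"
      "\<And>n z. z \<in> W n \<Longrightarrow> Re (h (Suc n) z) \<ge> C n + 1" by metis
  have smono: "m \<le> n \<Longrightarrow> s m \<le> s n" for m n
    by (rule lift_Suc_mono_le[of s]) (use st order_trans in blast)+
  \<comment> \<open>The subtracted term makes the induction close: it is the part of the geometric
    tail not yet spent.\<close>
  have tele: "norm (h (n + k) z - h n z) \<le> 2 * (1/2)^n - 2 * (1/2)^(n+k)" if "norm z \<le> s n" for n k z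
  proof (induction k)
    case (Suc k)
    have "norm z \<le> s (n + k)" using that smono[of n "n+k"] by simp
    then have "norm (h (Suc (n + k)) z - h (n + k) z) \<le> (1/2)^(n+k)" by (rule h(2))
    then show ?case
      using Suc norm_triangle_ineq[of "h (Suc (n + k)) z - h (n + k) z" "h (n + k) z - h n z"] by simp
  qed simp
  have tele': "norm (h m z - h n z) \<le> 2 * (1/2)^n" if "norm z \<le> s n" "n \<le> m" for m n z
  proof -
    obtain k where "m = n + k" using \<open>n \<le> m\<close> le_Suc_ex by blast
    moreover have "(0::real) \<le> 2 * (1/2)^(n+k)" by simp
    then have "norm (h (n + k) z - h n z) \<le> 2 * (1/2)^n"
      using tele[OF that(1), of k] by linarith
    ultimately show ?thesis by simp
  qed
  have ex: "\<exists>N. r \<le> s N" if "r < 1" for r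
    using order_tendstoD(1)[OF st(4) that] unfolding eventually_sequentially by (meson less_imp_le order_refl)
  have conv: "convergent (\<lambda>n. h n z)" if z: "norm z < 1" for z
  proof -
    obtain N where N: "norm z \<le> s N" using ex z by blast
    have "Cauchy (\<lambda>n. h n z)"
    proof (rule CauchyI)
      fix e :: real assume "e > 0"
      then obtain k where k: "(1/2)^k < e/4" using real_arch_pow_inv[of "e/4" "1/2"] by auto
      define n where "n = max N k"
      have n: "(1/2)^n < e/4"
        using k power_decreasing[of k n "1/2::real"] by (intro le_less_trans[OF _ k]) (simp add: n_def)
      have zn: "norm z \<le> s n" using N smono[of N n] by (simp add: n_def)
      have "norm (h m z - h l z) < e" if "m \<ge> n" "l \<ge> n" for m l
      proof -
        have "norm (h m z - h l z) \<le> norm (h m z - h n z) + norm (h l z - h n z)"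
          using norm_triangle_ineq4[of "h m z - h n z" "h l z - h n z"] by simp
        also have "\<dots> < e" using tele'[OF zn that(1)] tele'[OF zn that(2)] n by linarith
        finally show ?thesis .
      qed
      then show "\<exists>M. \<forall>m\<ge>M. \<forall>n\<ge>M. norm (h m z - h n z) < e" by blast
    qed
    then show ?thesis by (simp add: Cauchy_convergent_iff)
  qed
  define H where "H z = lim (\<lambda>n. h n z)" for z
  have close: "norm (h n z - H z) \<le> 2 * (1/2)^n" if "norm z < 1" "norm z \<le> s n" for n z
  proof -
    have "(\<lambda>m. h m z) \<longlonglongrightarrow> H z" using conv[OF that(1)] by (simp add: H_def convergent_LIMSEQ_iff)
    then have "(\<lambda>m. norm (h n z - h m z)) \<longlonglongrightarrow> norm (h n z - H z)" by (intro tendsto_intros)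
    moreover have "\<forall>\<^sub>F m in sequentially. norm (h n z - h m z) \<le> 2 * (1/2)^n"
      using tele'[OF that(2)] by (auto simp: eventually_sequentially norm_minus_commute intro!: exI[of _ n])
    ultimately show ?thesis by (rule tendsto_upperbound) simp
  qed
  show thesis
  proof (rule that[of H])
    show "H holomorphic_on ball 0 1"
    proof (rule holomorphic_uniform_sequence)
      fix x :: complex assume x: "x \<in> ball 0 1"
      define d where "d = (1 - norm x) / 2"
      have d: "d > 0" "norm x + d < 1" using x by (auto simp: d_def field_simps)
      obtain N where N: "norm x + d \<le> s N" using ex d by blast
      have zb: "norm z \<le> norm x + d" if "z \<in> cball x d" for z
        using that norm_triangle_ineq2[of z x] by (simp add: dist_norm norm_minus_commute)
      have "uniform_limit (cball x d) h H sequentially"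
      proof (rule uniform_limitI)
        fix e :: real assume "e > 0"
        then obtain k where k: "(1/2)^k < e/2" using real_arch_pow_inv[of "e/2" "1/2"] by auto
        have "dist (h n z) (H z) < e" if "n \<ge> max N k" "z \<in> cball x d" for n z
        proof -
          have "norm z < 1" "norm z \<le> s n" using zb[OF that(2)] d N smono[of N n] that by auto
          then have "norm (h n z - H z) \<le> 2 * (1/2)^n" by (rule close)
          moreover have "(1/2::real)^n \<le> (1/2)^k" using that by (intro power_decreasing) auto
          ultimately show ?thesis using k unfolding dist_norm by linarith
        qed
        then show "\<forall>\<^sub>F n in sequentially. \<forall>z\<in>cball x d. dist (h n z) (H z) < e"
          unfolding eventually_sequentially by blast
      qed
      moreover have "cball x d \<subseteq> ball 0 1" using zb d by (auto simp: subset_iff) (meson le_less_trans)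
      ultimately show "\<exists>d>0. cball x d \<subseteq> ball 0 1 \<and> uniform_limit (cball x d) h H sequentially"
        using d by blast
    qed (use h in \<open>auto intro: holomorphic_on_subset\<close>)
  next
    fix n z assume z: "z \<in> W n"
    have "norm z \<le> s (Suc n)" using W[of n] st(2)[of n] z by (auto simp: subset_iff)
    moreover have "norm z < 1" using calculation st(3)[of "Suc n"] by simp
    \<comment> \<open>The changes from index \<open>Suc n\<close> on sum to at most
      \<open>2 * (1/2)^(Suc n) \<le> 1\<close>, which is the reserve in
      \<open>C n + 1\<close>.\<close>
    ultimately have "norm (h (Suc n) z - H z) \<le> 1"
      using close[of z "Suc n"] power_decreasing[of 1 "Suc n" "1/2::real"] by simp
    then show "Re (H z) \<ge> C n"
      using h(3)[OF z] abs_Re_le_cmod[of "h (Suc n) z - H z"] by simp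
  qed
qed

section \<open>Harmonic functions and real parts of holomorphic functions\<close>

lemma has_derivative_pd:
  assumes "f differentiable at z"
  shows "(f has_derivative (\<lambda>v. Re v *\<^sub>R pdx f z + Im v *\<^sub>R pdy f z)) (at z)"
proof -
  interpret D: linear "frechet_derivative f (at z)"
    by (rule linear_frechet_derivative[OF assms])
  have "frechet_derivative f (at z) v = Re v *\<^sub>R pdx f z + Im v *\<^sub>R pdy f z" for v
  proof -
    have "v = Re v *\<^sub>R 1 + Im v *\<^sub>R \<i>" by (simp add: complex_eq_iff)
    then have "frechet_derivative f (at z) v = frechet_derivative f (at z) (Re v *\<^sub>R 1 + Im v *\<^sub>R \<i>)"
      by simp
    then show ?thesis by (simp only: D.add D.scale pdx_def pdy_def)
  qed
  then have "frechet_derivative f (at z) = (\<lambda>v. Re v *\<^sub>R pdx f z + Im v *\<^sub>R pdy f z)" by (rule ext)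
  then show ?thesis using assms by (metis frechet_derivative_works)
qed

lemma pd_eqI:
  assumes "(f has_derivative D) (at z)"
  shows "f differentiable at z" "pdx f z = D 1" "pdy f z = D \<i>"
  using assms frechet_derivative_at[OF assms] by (auto simp: pdx_def pdy_def differentiable_def)

lemma has_derivative_Re_field:
  assumes "open S" "z \<in> S" "\<And>w. w \<in> S \<Longrightarrow> u w = Re (F w)" "(F has_field_derivative d) (at z)"
  shows "(u has_derivative (\<lambda>v. Re (d * v))) (at z)"
proof -
  have "((\<lambda>w. Re (F w)) has_derivative (\<lambda>v. Re (d * v))) (at z)"
    using assms(4) unfolding has_field_derivative_def by (rule has_derivative_Re)
  then show ?thesis
    by (rule has_derivative_transform_within_open[OF _ assms(1,2)]) (simp add: assms(3))
qed

lemma pd_Re: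
  assumes "open S" "F holomorphic_on S" "\<And>w. w \<in> S \<Longrightarrow> u w = Re (F w)" "z \<in> S"
  shows "u differentiable at z" "pdx u z = Re (deriv F z)" "pdy u z = Re (\<i> * deriv F z)"
proof -
  have "(F has_field_derivative deriv F z) (at z)"
    using assms holomorphic_derivI by blast
  then have "(u has_derivative (\<lambda>v. Re (deriv F z * v))) (at z)"
    using assms has_derivative_Re_field by blast
  from pd_eqI[OF this]
  show "u differentiable at z" "pdx u z = Re (deriv F z)" "pdy u z = Re (\<i> * deriv F z)"
    by (auto simp: mult.commute)
qed

text \<open>Both first partials are again real parts of holomorphic functions, \<open>F'\<close> and
  \<open>\<i> * F'\<close>, so the first-order formulas can be iterated; the Laplacian is the real
  part of \<open>F'' + \<i> * \<i> * F''\<close>.\<close>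

lemma harmonic_on_Re:
  assumes S: "open S" and F: "F holomorphic_on S" and u: "\<And>w. w \<in> S \<Longrightarrow> u w = Re (F w)"
  shows "harmonic_on S u"
proof -
  have F': "deriv F holomorphic_on S" using F S by (rule holomorphic_deriv)
  then have iF': "(\<lambda>z. \<i> * deriv F z) holomorphic_on S"
    by (rule holomorphic_on_mult[OF holomorphic_on_const])
  have F'': "deriv (deriv F) holomorphic_on S" using F' S by (rule holomorphic_deriv)
  have d: "deriv (\<lambda>z. \<i> * deriv F z) z = \<i> * deriv (deriv F) z" if "z \<in> S" for z
    using F' S that by (intro deriv_cmult holomorphic_on_imp_differentiable_at[of _ S])
  have ux: "pdx u w = Re (deriv F w)" and uy: "pdy u w = Re (\<i> * deriv F w)" if "w \<in> S" for w
    using pd_Re[OF S F u that] by auto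
  note x = pd_Re[OF S F' ux]
  note y = pd_Re[OF S iF' uy]
  have c: "continuous_on S (\<lambda>z. Re (deriv (deriv F) z))" "continuous_on S (\<lambda>z. Re (\<i> * deriv (deriv F) z))"
    "continuous_on S (\<lambda>z. Re (\<i> * (\<i> * deriv (deriv F) z)))"
    by (intro continuous_intros holomorphic_on_imp_continuous_on[OF F''])+
  have eq: "pdx (pdx u) z = Re (deriv (deriv F) z)" "pdy (pdx u) z = Re (\<i> * deriv (deriv F) z)"
    "pdx (pdy u) z = Re (\<i> * deriv (deriv F) z)" "pdy (pdy u) z = Re (\<i> * (\<i> * deriv (deriv F) z))"
    if "z \<in> S" for z
    using x(2,3)[OF _ that] y(2,3)[OF _ that] by (simp_all add: d[OF that])
  have cont: "continuous_on S (pdx (pdx u))" "continuous_on S (pdy (pdx u))"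
    "continuous_on S (pdx (pdy u))" "continuous_on S (pdy (pdy u))"
    using c by (auto simp: eq cong: continuous_on_cong)
  show ?thesis
    unfolding harmonic_on_def C2_on_def
    using S cont pd_Re(1)[OF S F u] x(1) y(1) by (auto simp: eq)
qed

section \<open>Equality of mixed second partials\<close>

lemma has_real_derivative_pdx:
  fixes u :: "complex \<Rightarrow> real"
  assumes "u differentiable at (w + of_real t)"
  shows "((\<lambda>t. u (w + of_real t)) has_real_derivative pdx u (w + of_real t)) (at t)"
proof -
  have "((\<lambda>t. w + complex_of_real t) has_derivative (\<lambda>h. of_real h)) (at t)"
    by (auto intro!: derivative_eq_intros)
  from has_derivative_compose[OF this has_derivative_pd[OF assms]] show ?thesis
    unfolding has_field_derivative_def
    by (rule back_subst[where P = "\<lambda>D. (_ has_derivative D) _"]) (auto simp: o_def)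
qed

lemma has_real_derivative_pdy:
  fixes u :: "complex \<Rightarrow> real"
  assumes "u differentiable at (w + \<i> * of_real t)"
  shows "((\<lambda>t. u (w + \<i> * of_real t)) has_real_derivative pdy u (w + \<i> * of_real t)) (at t)"
proof -
  have "((\<lambda>t. w + \<i> * complex_of_real t) has_derivative (\<lambda>h. \<i> * of_real h)) (at t)"
    by (auto intro!: derivative_eq_intros)
  from has_derivative_compose[OF this has_derivative_pd[OF assms]] show ?thesis
    unfolding has_field_derivative_def
    by (rule back_subst[where P = "\<lambda>D. (_ has_derivative D) _"]) (auto simp: o_def)
qed

text \<open>The mean value theorem twice on the second difference over a square: first horizontally,
  for the difference between top and bottom edge, then vertically.\<close>

lemma mixed_difference_pdy_pdx:
  fixes u :: "complex \<Rightarrow> real"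
  assumes "h > 0" and "\<And>s t. 0 \<le> s \<Longrightarrow> s \<le> h \<Longrightarrow> 0 \<le> t \<Longrightarrow> t \<le> h \<Longrightarrow>
      u differentiable at (z + of_real s + \<i> * of_real t) \<and>
      pdx u differentiable at (z + of_real s + \<i> * of_real t)"
  obtains s t where "0 < s" "s < h" "0 < t" "t < h"
    "u (z + of_real h + \<i> * of_real h) - u (z + of_real h) - u (z + \<i> * of_real h) + u z
       = h * h * pdy (pdx u) (z + of_real s + \<i> * of_real t)"
proof -
  define \<phi> where "\<phi> s = u (z + \<i> * of_real h + of_real s) - u (z + of_real s)" for s
  have "(\<phi> has_real_derivative pdx u (z + \<i> * of_real h + of_real s) - pdx u (z + of_real s)) (at s)"
    if "0 \<le> s" "s \<le> h" for s
    unfolding \<phi>_def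
    using assms(2)[OF that, of h] assms(2)[OF that, of 0] \<open>h > 0\<close>
    by (intro DERIV_diff has_real_derivative_pdx) (auto simp: add_ac)
  from MVT2[OF \<open>h > 0\<close> this] obtain s where s: "0 < s" "s < h"
    "\<phi> h - \<phi> 0 = h * (pdx u (z + \<i> * of_real h + of_real s) - pdx u (z + of_real s))" by auto
  have "((\<lambda>t. pdx u (z + of_real s + \<i> * of_real t)) has_real_derivative
      pdy (pdx u) (z + of_real s + \<i> * of_real t)) (at t)" if "0 \<le> t" "t \<le> h" for t
    using assms(2)[of s t] s that by (intro has_real_derivative_pdy) auto
  from MVT2[OF \<open>h > 0\<close> this] obtain t where t: "0 < t" "t < h"
    "pdx u (z + of_real s + \<i> * of_real h) - pdx u (z + of_real s)
       = h * pdy (pdx u) (z + of_real s + \<i> * of_real t)" by auto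
  show thesis
    by (rule that[OF s(1,2) t(1,2)]) (use s(3) t(3) in \<open>simp add: \<phi>_def add_ac\<close>)
qed

text \<open>The same second difference, with the two directions taken in the other order.\<close>

lemma mixed_difference_pdx_pdy:
  fixes u :: "complex \<Rightarrow> real"
  assumes "h > 0" and "\<And>s t. 0 \<le> s \<Longrightarrow> s \<le> h \<Longrightarrow> 0 \<le> t \<Longrightarrow> t \<le> h \<Longrightarrow>
      u differentiable at (z + of_real s + \<i> * of_real t) \<and>
      pdy u differentiable at (z + of_real s + \<i> * of_real t)"
  obtains s t where "0 < s" "s < h" "0 < t" "t < h"
    "u (z + of_real h + \<i> * of_real h) - u (z + of_real h) - u (z + \<i> * of_real h) + u z
       = h * h * pdx (pdy u) (z + of_real s + \<i> * of_real t)"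
proof -
  define \<phi> where "\<phi> t = u (z + of_real h + \<i> * of_real t) - u (z + \<i> * of_real t)" for t
  have "(\<phi> has_real_derivative pdy u (z + of_real h + \<i> * of_real t) - pdy u (z + \<i> * of_real t)) (at t)"
    if "0 \<le> t" "t \<le> h" for t
    unfolding \<phi>_def
    using assms(2)[OF _ _ that, of h] assms(2)[OF _ _ that, of 0] \<open>h > 0\<close>
    by (intro DERIV_diff has_real_derivative_pdy) (auto simp: add_ac)
  from MVT2[OF \<open>h > 0\<close> this] obtain t where t: "0 < t" "t < h"
    "\<phi> h - \<phi> 0 = h * (pdy u (z + of_real h + \<i> * of_real t) - pdy u (z + \<i> * of_real t))" by auto
  have "((\<lambda>s. pdy u (z + \<i> * of_real t + of_real s)) has_real_derivative
      pdx (pdy u) (z + \<i> * of_real t + of_real s)) (at s)" if "0 \<le> s" "s \<le> h" for s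
    using assms(2)[of s t] t that by (intro has_real_derivative_pdx) (auto simp: add_ac)
  from MVT2[OF \<open>h > 0\<close> this] obtain s where s: "0 < s" "s < h"
    "pdy u (z + \<i> * of_real t + of_real h) - pdy u (z + \<i> * of_real t)
       = h * pdx (pdy u) (z + \<i> * of_real t + of_real s)" by auto
  show thesis
    by (rule that[OF s(1,2) t(1,2)]) (use s(3) t(3) in \<open>simp add: \<phi>_def add_ac\<close>)
qed

text \<open>\<open>C2_on\<close> only demands that the mixed partials be continuous. Both are values
  of one second difference divided by \<open>h * h\<close>, so they agree at two points of an
  arbitrarily small square, and continuity carries the equality to \<open>z\<close>.\<close>

lemma C2_on_mixed_partials:
  fixes u :: "complex \<Rightarrow> real"
  assumes "C2_on S u" "z \<in> S"
  shows "pdx (pdy u) z = pdy (pdx u) z"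
proof (rule ccontr)
  assume ne: "pdx (pdy u) z \<noteq> pdy (pdx u) z"
  define e where "e = \<bar>pdx (pdy u) z - pdy (pdx u) z\<bar> / 2"
  have "e > 0" using ne by (simp add: e_def)
  have S: "open S" and diff: "\<And>w. w \<in> S \<Longrightarrow> u differentiable at w \<and> pdx u differentiable at w \<and> pdy u differentiable at w"
    and cont: "continuous_on S (pdy (pdx u))" "continuous_on S (pdx (pdy u))"
    using assms(1) by (auto simp: C2_on_def)
  obtain r where r: "r > 0" "ball z r \<subseteq> S" using S assms(2) openE by blast
  have "isCont (pdy (pdx u)) z" "isCont (pdx (pdy u)) z"
    using cont S assms(2) by (simp_all add: continuous_on_eq_continuous_at)
  then obtain d1 d2 where d: "d1 > 0" "\<And>w. dist w z < d1 \<Longrightarrow> dist (pdy (pdx u) w) (pdy (pdx u) z) < e"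
      "d2 > 0" "\<And>w. dist w z < d2 \<Longrightarrow> dist (pdx (pdy u) w) (pdx (pdy u) z) < e"
    using \<open>e > 0\<close> unfolding continuous_at_eps_delta by metis
  \<comment> \<open>Points of the square of side \<open>h\<close> at \<open>z\<close> are within
    \<open>2 * h\<close> of \<open>z\<close>, hence the division by 3.\<close>
  define h where "h = min r (min d1 d2) / 3"
  have h: "h > 0" "2 * h < r" "2 * h < d1" "2 * h < d2" using r d by (auto simp: h_def)
  have near: "dist (z + of_real s + \<i> * of_real t) z \<le> 2 * h"
    if "0 \<le> s" "s \<le> h" "0 \<le> t" "t \<le> h" for s t
  proof -
    have "dist (z + of_real s + \<i> * of_real t) z = norm (of_real s + \<i> * of_real t)"
      by (simp add: dist_norm)
    also have "\<dots> \<le> \<bar>s\<bar> + \<bar>t\<bar>"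
      by (rule order_trans[OF norm_triangle_ineq]) (simp add: norm_mult)
    finally show ?thesis using that by simp
  qed
  have inS: "z + of_real s + \<i> * of_real t \<in> S" if "0 \<le> s" "s \<le> h" "0 \<le> t" "t \<le> h" for s t
    using near[OF that] h r by (auto simp: subset_iff dist_commute)
  let ?\<Delta> = "u (z + of_real h + \<i> * of_real h) - u (z + of_real h) - u (z + \<i> * of_real h) + u z"
  obtain s t where st: "0 < s" "s < h" "0 < t" "t < h"
      "?\<Delta> = h * h * pdy (pdx u) (z + of_real s + \<i> * of_real t)"
    using mixed_difference_pdy_pdx[OF h(1), of u z] diff inS by blast
  obtain s' t' where st': "0 < s'" "s' < h" "0 < t'" "t' < h"
      "?\<Delta> = h * h * pdx (pdy u) (z + of_real s' + \<i> * of_real t')"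
    using mixed_difference_pdx_pdy[OF h(1), of u z] diff inS by blast
  have "pdy (pdx u) (z + of_real s + \<i> * of_real t) = pdx (pdy u) (z + of_real s' + \<i> * of_real t')"
    using st(5) st'(5) h(1) by simp
  moreover have "dist (pdy (pdx u) (z + of_real s + \<i> * of_real t)) (pdy (pdx u) z) < e"
    using near[of s t] st h by (intro d) auto
  moreover have "dist (pdx (pdy u) (z + of_real s' + \<i> * of_real t')) (pdx (pdy u) z) < e"
    using near[of s' t'] st' h by (intro d) auto
  moreover have "dist (pdx (pdy u) z) (pdy (pdx u) z) = 2 * e" by (simp add: e_def dist_real_def)
  ultimately show False
    using dist_triangle3[of "pdx (pdy u) z" "pdy (pdx u) z" "pdy (pdx u) (z + of_real s + \<i> * of_real t)"]
    by simp
qed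

text \<open>The function \<open>pdx u - \<i> * pdy u\<close> satisfies the Cauchy-Riemann equations:
  one is Laplace's equation, the other the symmetry of the mixed partials. The real part of its
  primitive has the same differential as \<open>u\<close>.\<close>

lemma harmonic_on_eq_Re:
  assumes "convex S" "harmonic_on S u"
  obtains h where "h holomorphic_on S" "\<And>z. z \<in> S \<Longrightarrow> u z = Re (h z)"
proof -
  have C2: "C2_on S u" and lap: "\<And>z. z \<in> S \<Longrightarrow> pdx (pdx u) z + pdy (pdy u) z = 0"
    using assms(2) by (auto simp: harmonic_on_def)
  have S: "open S" and diff: "\<And>w. w \<in> S \<Longrightarrow> u differentiable at w \<and> pdx u differentiable at w \<and> pdy u differentiable at w"
    using C2 by (auto simp: C2_on_def)
  define f where "f z = Complex (pdx u z) (- pdy u z)" for z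
  have "(f has_field_derivative Complex (pdx (pdx u) z) (- pdy (pdx u) z)) (at z)" if z: "z \<in> S" for z
  proof -
    have 1: "(pdx u has_derivative (\<lambda>v. Re v *\<^sub>R pdx (pdx u) z + Im v *\<^sub>R pdy (pdx u) z)) (at z)"
      "(pdy u has_derivative (\<lambda>v. Re v *\<^sub>R pdx (pdy u) z + Im v *\<^sub>R pdy (pdy u) z)) (at z)"
      using diff[OF z] by (blast intro: has_derivative_pd)+
    have "((\<lambda>z. of_real (pdx u z) - \<i> * of_real (pdy u z)) has_derivative
       (\<lambda>v. of_real (Re v *\<^sub>R pdx (pdx u) z + Im v *\<^sub>R pdy (pdx u) z)
          - \<i> * of_real (Re v *\<^sub>R pdx (pdy u) z + Im v *\<^sub>R pdy (pdy u) z))) (at z)"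
      by (intro has_derivative_diff has_derivative_mult_right has_derivative_of_real 1)
    moreover have "(\<lambda>z. of_real (pdx u z) - \<i> * of_real (pdy u z)) = f"
      by (auto simp: f_def complex_eq_iff)
    moreover have "(\<lambda>v. of_real (Re v *\<^sub>R pdx (pdx u) z + Im v *\<^sub>R pdy (pdx u) z)
          - \<i> * of_real (Re v *\<^sub>R pdx (pdy u) z + Im v *\<^sub>R pdy (pdy u) z))
        = (*) (Complex (pdx (pdx u) z) (- pdy (pdx u) z))"
    proof -
      have "pdy (pdy u) z = - pdx (pdx u) z" using lap[OF z] by simp
      then show ?thesis
        using C2_on_mixed_partials[OF C2 z] by (auto simp: complex_eq_iff algebra_simps)
    qed
    ultimately show ?thesis by (simp add: has_field_derivative_def)
  qed
  then have "f holomorphic_on S" using holomorphic_onI S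
    by (metis field_differentiable_at_within field_differentiable_def)
  then obtain g where g: "\<And>z. z \<in> S \<Longrightarrow> (g has_field_derivative f z) (at z within S)"
    using holomorphic_convex_primitive'[OF assms(1) S] by blast
  have g': "(g has_field_derivative f z) (at z)" if "z \<in> S" for z
    using g[OF that] at_within_open[OF that S] by simp
  have "((\<lambda>w. u w - Re (g w)) has_derivative (\<lambda>v. 0)) (at z within S)" if z: "z \<in> S" for z
  proof -
    have "((\<lambda>w. u w - Re (g w)) has_derivative
        (\<lambda>v. (Re v *\<^sub>R pdx u z + Im v *\<^sub>R pdy u z) - Re (f z * v))) (at z)"
      using diff[OF z] has_derivative_Re_field[OF S z refl g'[OF z]]
      by (intro has_derivative_diff has_derivative_pd) auto
    moreover have "(\<lambda>v. (Re v *\<^sub>R pdx u z + Im v *\<^sub>R pdy u z) - Re (f z * v)) = (\<lambda>v. 0)"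
      by (rule ext) (simp add: f_def)
    ultimately have "((\<lambda>w. u w - Re (g w)) has_derivative (\<lambda>v. 0)) (at z)" by simp
    then show ?thesis by (rule has_derivative_at_withinI)
  qed
  then obtain c where c: "\<And>z. z \<in> S \<Longrightarrow> u z - Re (g z) = c"
    using has_derivative_zero_constant[OF assms(1), of "\<lambda>w. u w - Re (g w)"] by blast
  show thesis
  proof (rule that[of "\<lambda>z. g z + of_real c"])
    have "g holomorphic_on S" using g' S
      by (metis holomorphic_on_open)
    then show "(\<lambda>z. g z + of_real c) holomorphic_on S" by (intro holomorphic_intros)
  qed (use c in \<open>auto simp: algebra_simps\<close>)
qed

section \<open>Length of curves\<close>

text \<open>A lower bound for the length is certified by a single partition of a compact parameter
  interval, so that pieces can be concatenated in the reals, without suprema.\<close>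

definition polygonal_length_ge :: "(real \<Rightarrow> 'a::metric_space) \<Rightarrow> real \<Rightarrow> real \<Rightarrow> real \<Rightarrow> bool" where
  "polygonal_length_ge c a b x \<longleftrightarrow> (\<exists>(n::nat) t. (\<forall>i\<le>n. t i \<in> {a..b}) \<and> (\<forall>i<n. t i \<le> t (Suc i)) \<and>
     x \<le> (\<Sum>i<n. dist (c (t i)) (c (t (Suc i)))))"

lemma polygonal_length_ge_mono:
  assumes "polygonal_length_ge c a b x" "a' \<le> a" "b \<le> b'" "x' \<le> x"
  shows "polygonal_length_ge c a' b' x'"
proof -
  obtain n t where "\<forall>i\<le>n. t i \<in> {a..b}" "\<forall>i<n. t i \<le> t (Suc i)"
    "x \<le> (\<Sum>i<n. dist (c (t i)) (c (t (Suc i))))"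
    using assms(1) unfolding polygonal_length_ge_def by blast
  then show ?thesis unfolding polygonal_length_ge_def using assms(2-4)
    by (intro exI[of _ n] exI[of _ t]) (auto intro: order_trans)
qed

lemma polygonal_length_ge_add:
  assumes "polygonal_length_ge c a b x" "polygonal_length_ge c b d y" "a \<le> b" "b \<le> d"
  shows "polygonal_length_ge c a d (x + y)"
proof -
  obtain n t where t: "\<And>i. i \<le> n \<Longrightarrow> t i \<in> {a..b}" "\<And>i. i < n \<Longrightarrow> t i \<le> t (Suc i)"
    "x \<le> (\<Sum>i<n. dist (c (t i)) (c (t (Suc i))))"
    using assms(1) unfolding polygonal_length_ge_def by blast
  obtain m s where s: "\<And>i. i \<le> m \<Longrightarrow> s i \<in> {b..d}" "\<And>i. i < m \<Longrightarrow> s i \<le> s (Suc i)"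
    "y \<le> (\<Sum>i<m. dist (c (s i)) (c (s (Suc i))))"
    using assms(2) unfolding polygonal_length_ge_def by blast
  \<comment> \<open>The shift by \<open>Suc n\<close> keeps both partitions whole: an extra edge
    from \<open>t n\<close> to \<open>s 0\<close> joins them and can only add length.\<close>
  define w where "w i = (if i \<le> n then t i else s (i - Suc n))" for i
  have split: "(\<Sum>i<Suc n + m. f i) = (\<Sum>i<n. f i) + f n + (\<Sum>i<m. f (Suc n + i))" for f :: "nat \<Rightarrow> real"
    by (induction m) auto
  show ?thesis unfolding polygonal_length_ge_def
  proof (intro exI[of _ "Suc n + m"] exI[of _ w] conjI allI impI)
    fix i assume i: "i \<le> Suc n + m"
    show "w i \<in> {a..d}"
    proof (cases "i \<le> n")
      case True
      then show ?thesis using t(1)[OF True] assms(3,4) by (simp add: w_def)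
    next
      case False
      then have "s (i - Suc n) \<in> {b..d}" using i by (intro s(1)) simp
      then show ?thesis using False assms(3,4) by (simp add: w_def)
    qed
  next
    fix i assume i: "i < Suc n + m"
    consider "i < n" | "i = n" | "i > n" by linarith
    then show "w i \<le> w (Suc i)"
    proof cases
      case 2
      then show ?thesis using t(1)[of n] s(1)[of 0] by (auto simp: w_def)
    next
      case 3
      then have "Suc (i - Suc n) = i - n" by simp
      then show ?thesis using 3 i s(2)[of "i - Suc n"] by (auto simp: w_def)
    qed (use t(2)[of i] in \<open>auto simp: w_def\<close>)
  next
    have "(\<Sum>i<n. dist (c (w i)) (c (w (Suc i)))) = (\<Sum>i<n. dist (c (t i)) (c (t (Suc i))))"
      by (rule sum.cong) (auto simp: w_def)
    moreover have "(\<Sum>i<m. dist (c (w (Suc n + i))) (c (w (Suc (Suc n + i)))))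
        = (\<Sum>i<m. dist (c (s i)) (c (s (Suc i))))"
      by (rule sum.cong) (auto simp: w_def)
    moreover have "0 \<le> dist (c (w n)) (c (w (Suc n)))" by simp
    ultimately show "x + y \<le> (\<Sum>i<Suc n + m. dist (c (w i)) (c (w (Suc i))))"
      unfolding split using t(3) s(3) by linarith
  qed
qed

lemma curve_length_infinite:
  assumes "\<And>N::nat. \<exists>a b. {a..b} \<subseteq> I \<and> polygonal_length_ge c a b N"
  shows "curve_length I c = \<infinity>"
proof -
  have "ereal N \<le> curve_length I c" for N :: nat
  proof -
    obtain a b n t where ab: "{a..b} \<subseteq> I" and t: "\<forall>i\<le>n. t i \<in> {a..b}" "\<forall>i<n. t i \<le> t (Suc i)"
      "N \<le> (\<Sum>i<n. dist (c (t i)) (c (t (Suc i))))"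
      using assms[of N] unfolding polygonal_length_ge_def by blast
    have "ereal N \<le> ereal (\<Sum>i<n. dist (c (t i)) (c (t (Suc i))))" using t(3) by simp
    also have "\<dots> \<le> curve_length I c"
      unfolding curve_length_def by (rule SUP_upper2[of "(n, t)"]) (use ab t in auto)
    finally show ?thesis .
  qed
  then have "\<And>x. ereal x \<le> curve_length I c"
    by (meson ereal_less_eq(3) order_trans real_arch_simple)
  then show ?thesis by (meson ereal_top)
qed

section \<open>Stretching of curves\<close>

text \<open>The integrated form of a lower bound \<open>l\<close> for the conformal factor on
  \<open>K\<close>. Only the distance of the endpoints enters, so it makes sense for merely
  continuous curves, as completeness requires here.\<close>

definition expands_curves :: "(complex \<Rightarrow> 'a::metric_space) \<Rightarrow> complex set \<Rightarrow> real \<Rightarrow> bool" where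
  "expands_curves Y K l \<longleftrightarrow> (\<forall>\<gamma> a b. a \<le> b \<and> continuous_on {a..b} \<gamma> \<and> \<gamma> ` {a..b} \<subseteq> K \<longrightarrow>
     polygonal_length_ge (Y \<circ> \<gamma>) a b (l * dist (\<gamma> a) (\<gamma> b)))"

lemma dist_le_sum_dist:
  fixes p :: "nat \<Rightarrow> 'a::metric_space"
  shows "dist (p 0) (p n) \<le> (\<Sum>i<n. dist (p i) (p (Suc i)))"
proof (induction n)
  case (Suc n)
  then show ?case using dist_triangle[of "p 0" "p (Suc n)" "p n"] by simp
qed simp

lemma expands_curves_local:
  fixes Y :: "complex \<Rightarrow> 'a::metric_space"
  assumes "compact K" "l \<ge> 0"
    and loc: "\<And>z. z \<in> K \<Longrightarrow> \<exists>G. open G \<and> z \<in> G \<and> (\<forall>v\<in>G. \<forall>w\<in>G. l * dist v w \<le> dist (Y v) (Y w))"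
  shows "expands_curves Y K l"
  unfolding expands_curves_def
proof (intro allI impI)
  fix \<gamma> :: "real \<Rightarrow> complex" and a b assume \<gamma>: "a \<le> b \<and> continuous_on {a..b} \<gamma> \<and> \<gamma> ` {a..b} \<subseteq> K"
  define \<G> where "\<G> = {G. open G \<and> (\<forall>v\<in>G. \<forall>w\<in>G. l * dist v w \<le> dist (Y v) (Y w))}"
  have cover: "K \<subseteq> \<Union>\<G>" and op: "\<And>G. G \<in> \<G> \<Longrightarrow> open G" unfolding \<G>_def using loc by blast+
  \<comment> \<open>\<open>e\<close> is a Lebesgue number of the cover; uniform continuity then cuts
    the curve into pieces with both ends in a single \<open>G\<close>.\<close>
  obtain e where e: "e > 0" "\<And>z. z \<in> K \<Longrightarrow> \<exists>G\<in>\<G>. ball z e \<subseteq> G"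
    using Heine_Borel_lemma[OF assms(1) cover op] by metis
  have "uniformly_continuous_on {a..b} \<gamma>" using \<gamma> by (intro compact_uniformly_continuous) auto
  then obtain d where d: "d > 0"
      "\<And>s t. s \<in> {a..b} \<Longrightarrow> t \<in> {a..b} \<Longrightarrow> dist s t < d \<Longrightarrow> dist (\<gamma> s) (\<gamma> t) < e"
    unfolding uniformly_continuous_on_def using e(1) by metis
  obtain n where n: "(b - a) / d < real n" using reals_Archimedean2 by blast
  have "n > 0"
  proof (rule ccontr)
    assume "\<not> n > 0"
    then show False using n \<gamma> d(1) by (simp add: divide_less_0_iff)
  qed
  define h where "h = (b - a) / n"
  have h: "0 \<le> h" "h < d" "n * h = b - a" using n \<gamma> d(1) \<open>n > 0\<close> by (auto simp: h_def field_simps)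
  define t where "t i = a + real i * h" for i
  have tab: "t i \<in> {a..b}" if "i \<le> n" for i
  proof -
    have "real i * h \<le> n * h" using that h by (intro mult_right_mono) auto
    then show ?thesis using h by (simp add: t_def)
  qed
  have step: "l * dist (\<gamma> (t i)) (\<gamma> (t (Suc i))) \<le> dist ((Y \<circ> \<gamma>) (t i)) ((Y \<circ> \<gamma>) (t (Suc i)))"
    if "i < n" for i
  proof -
    have ti: "t i \<in> {a..b}" "t (Suc i) \<in> {a..b}" using tab that by auto
    have "dist (t i) (t (Suc i)) < d" using h by (simp add: t_def dist_real_def algebra_simps)
    then have 1: "\<gamma> (t (Suc i)) \<in> ball (\<gamma> (t i)) e" using d(2)[OF ti] by simp
    have "\<gamma> (t i) \<in> K" using \<gamma> ti by blast
    then obtain G where G: "ball (\<gamma> (t i)) e \<subseteq> G" "\<forall>v\<in>G. \<forall>w\<in>G. l * dist v w \<le> dist (Y v) (Y w)"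
      using e(2) unfolding \<G>_def by blast
    have "\<gamma> (t i) \<in> G" "\<gamma> (t (Suc i)) \<in> G" using G(1) 1 e(1) by auto
    then show ?thesis using G(2) by simp
  qed
  have "t 0 = a" "t n = b" using h by (auto simp: t_def)
  then have "l * dist (\<gamma> a) (\<gamma> b) \<le> l * (\<Sum>i<n. dist (\<gamma> (t i)) (\<gamma> (t (Suc i))))"
    using dist_le_sum_dist[of "\<lambda>i. \<gamma> (t i)" n] assms(2) by (intro mult_left_mono) auto
  also have "\<dots> \<le> (\<Sum>i<n. dist ((Y \<circ> \<gamma>) (t i)) ((Y \<circ> \<gamma>) (t (Suc i))))"
    unfolding sum_distrib_left by (intro sum_mono step) simp
  finally show "polygonal_length_ge (Y \<circ> \<gamma>) a b (l * dist (\<gamma> a) (\<gamma> b))"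
    unfolding polygonal_length_ge_def using tab h(1)
    by (intro exI[of _ n] exI[of _ t]) (auto simp: t_def algebra_simps)
qed

text \<open>Half of the infinitesimal stretching survives on a neighbourhood where \<open>dY\<close> varies little.\<close>
lemma expands_curves_C1:
  fixes Y :: "complex \<Rightarrow> 'a::real_normed_vector"
  assumes S: "open S" and K: "compact K" "K \<subseteq> S"
    and diff: "\<And>z. z \<in> S \<Longrightarrow> Y differentiable at z"
    and cont: "continuous_on S (pdx Y)" "continuous_on S (pdy Y)"
    and l: "l > 0" "\<And>z v. z \<in> K \<Longrightarrow> l * norm v \<le> norm (Re v *\<^sub>R pdx Y z + Im v *\<^sub>R pdy Y z)"
  shows "expands_curves Y K (l / 2)"
proof (rule expands_curves_local[OF K(1)])
  show "0 \<le> l / 2" using l by simp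
  fix z assume z: "z \<in> K"
  then have zS: "z \<in> S" using K by blast
  have "isCont (pdx Y) z" "isCont (pdy Y) z"
    using cont S zS by (simp_all add: continuous_on_eq_continuous_at)
  moreover have "l / 4 > 0" using l by simp
  ultimately obtain d1 d2 where d: "d1 > 0" "\<And>w. dist w z < d1 \<Longrightarrow> dist (pdx Y w) (pdx Y z) < l/4"
      "d2 > 0" "\<And>w. dist w z < d2 \<Longrightarrow> dist (pdy Y w) (pdy Y z) < l/4"
    unfolding continuous_at_eps_delta by metis
  obtain r where r: "r > 0" "ball z r \<subseteq> S" using S zS openE by blast
  \<comment> \<open>A convex neighbourhood within \<open>S\<close> rather than within
    \<open>K\<close>: walls are not convex, and segments between their points may leave
    them.\<close>
  define G where "G = ball z (min r (min d1 d2))"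
  have G: "w \<in> S" "norm (pdx Y w - pdx Y z) < l/4" "norm (pdy Y w - pdy Y z) < l/4" if "w \<in> G" for w
    using that r d by (auto simp: G_def dist_commute dist_norm)
  let ?D = "\<lambda>w v. Re v *\<^sub>R pdx Y w + Im v *\<^sub>R pdy Y w"
  have lin: "bounded_linear (?D w)" for w
    by (intro bounded_linear_add bounded_linear_scaleR_const bounded_linear_Re bounded_linear_Im)
  have "l / 2 * dist v w \<le> dist (Y v) (Y w)" if vw: "v \<in> G" "w \<in> G" for v w
  proof -
    \<comment> \<open>Mean value inequality for the deviation of \<open>Y\<close> from its linear
      part at \<open>z\<close>. The two partials contribute \<open>l/4\<close> each, which costs
      half of \<open>l\<close>.\<close>
    have "norm ((Y v - ?D z v) - (Y w - ?D z w)) \<le> l / 2 * norm (v - w)"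
    proof (rule differentiable_bound[of G "\<lambda>x. Y x - ?D z x" "\<lambda>x v. ?D x v - ?D z v"])
      show "convex G" by (simp add: G_def)
      fix x assume x: "x \<in> G"
      have "((\<lambda>x. Y x - ?D z x) has_derivative (\<lambda>v. ?D x v - ?D z v)) (at x)"
        using G(1)[OF x] by (intro has_derivative_diff has_derivative_pd diff
            bounded_linear_imp_has_derivative lin)
      then show "((\<lambda>x. Y x - ?D z x) has_derivative (\<lambda>v. ?D x v - ?D z v)) (at x within G)"
        by (rule has_derivative_at_withinI)
      show "onorm (\<lambda>v. ?D x v - ?D z v) \<le> l / 2"
      proof (rule onorm_bound)
        fix v
        have "?D x v - ?D z v = Re v *\<^sub>R (pdx Y x - pdx Y z) + Im v *\<^sub>R (pdy Y x - pdy Y z)"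
          by (simp add: algebra_simps)
        then have "norm (?D x v - ?D z v) \<le> \<bar>Re v\<bar> * norm (pdx Y x - pdx Y z) + \<bar>Im v\<bar> * norm (pdy Y x - pdy Y z)"
          by (metis norm_scaleR norm_triangle_ineq)
        also have "\<dots> \<le> norm v * (l/4) + norm v * (l/4)"
          using G(2,3)[OF x] abs_Re_le_cmod[of v] abs_Im_le_cmod[of v]
          by (intro add_mono mult_mono) auto
        finally show "norm (?D x v - ?D z v) \<le> l / 2 * norm v" by simp
      qed (use l in simp)
    qed (use vw in auto)
    moreover have "(Y v - ?D z v) - (Y w - ?D z w) = (Y v - Y w) - ?D z (v - w)"
      by (simp add: algebra_simps)
    moreover have "l * norm (v - w) \<le> norm (?D z (v - w))" using l(2)[OF z] .
    moreover have "norm (?D z (v - w)) - norm (Y v - Y w) \<le> norm ((Y v - Y w) - ?D z (v - w))"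
      by (metis norm_minus_commute norm_triangle_ineq2)
    ultimately show ?thesis by (simp add: dist_norm)
  qed
  moreover have "open G" "z \<in> G" using r d by (auto simp: G_def)
  ultimately show "\<exists>G. open G \<and> z \<in> G \<and> (\<forall>v\<in>G. \<forall>w\<in>G. l / 2 * dist v w \<le> dist (Y v) (Y w))" by blast
qed

section \<open>Curves crossing annuli and walls\<close>

text \<open>Take for \<open>b'\<close> the first time at which \<open>g\<close> reaches
  \<open>y\<close>, and for \<open>a'\<close> the last time before it at which \<open>g\<close> is
  at most \<open>x\<close>.\<close>

lemma crossing_interval:
  fixes g :: "real \<Rightarrow> real"
  assumes "continuous_on {a..b} g" "a \<le> b" "g a \<le> x" "x \<le> y" "y \<le> g b"
  obtains a' b' where "a \<le> a'" "a' \<le> b'" "b' \<le> b" "g a' = x" "g b' = y"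
    "\<And>t. t \<in> {a'..b'} \<Longrightarrow> x \<le> g t \<and> g t \<le> y"
proof -
  have "compact ({a..b} \<inter> g -` {y..})"
    using continuous_closed_preimage[OF assms(1), of "{y..}"] by (simp add: compact_eq_bounded_closed bounded_Int)
  moreover have "b \<in> {a..b} \<inter> g -` {y..}" using assms by auto
  ultimately obtain b' where b': "b' \<in> {a..b} \<inter> g -` {y..}" "\<And>t. t \<in> {a..b} \<inter> g -` {y..} \<Longrightarrow> b' \<le> t"
    using compact_attains_inf by (metis empty_iff)
  have c': "continuous_on {a..b'} g" using assms(1) b' by (auto intro: continuous_on_subset)
  obtain t where "a \<le> t" "t \<le> b'" "g t = y"
    using IVT'[of g a y b'] c' b' assms by auto
  then have gb': "g b' = y" using b'(1) b'(2)[of t] by fastforce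
  have "compact ({a..b'} \<inter> g -` {..x})"
    using continuous_closed_preimage[OF c', of "{..x}"] by (simp add: compact_eq_bounded_closed bounded_Int)
  moreover have "a \<in> {a..b'} \<inter> g -` {..x}" using assms b' by auto
  ultimately obtain a' where a': "a' \<in> {a..b'} \<inter> g -` {..x}" "\<And>t. t \<in> {a..b'} \<inter> g -` {..x} \<Longrightarrow> t \<le> a'"
    using compact_attains_sup by (metis empty_iff)
  have "continuous_on {a'..b'} g" using c' a' by (auto intro: continuous_on_subset)
  then obtain t where "a' \<le> t" "t \<le> b'" "g t = x"
    using IVT'[of g a' x b'] a' gb' assms by auto
  then have ga': "g a' = x" using a'(1) a'(2)[of t] by fastforce
  show thesis
  proof (rule that[of a' b'])
    fix t assume t: "t \<in> {a'..b'}"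
    have "x \<le> g t"
    proof (rule ccontr)
      assume "\<not> x \<le> g t"
      then have "t \<le> a'" using a' t b' by (intro a'(2)) auto
      then show False using t ga' \<open>\<not> x \<le> g t\<close> by auto
    qed
    moreover have "g t \<le> y"
    proof (rule ccontr)
      assume "\<not> g t \<le> y"
      then have "b' \<le> t" using a' t b' by (intro b'(2)) auto
      then show False using t gb' \<open>\<not> g t \<le> y\<close> by auto
    qed
    ultimately show "x \<le> g t \<and> g t \<le> y" by simp
  qed (use a' b' ga' gb' in auto)
qed

text \<open>A curve that avoids the half-plane cut out of the wall stays inside the wall while its
  modulus runs from \<open>r\<close> to \<open>s\<close>, and there the radial distance
  \<open>s - r\<close> is stretched by \<open>C\<close>.\<close>

lemma wall_crossing:
  fixes \<gamma> :: "real \<Rightarrow> complex"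
  assumes "continuous_on {a..b} \<gamma>" "a \<le> b" "norm (\<gamma> a) \<le> r" "r \<le> s" "s \<le> norm (\<gamma> b)"
    and "expands_curves Y (wall \<sigma> r s) C" "m \<le> C * (s - r)" "C \<ge> 0"
  shows "polygonal_length_ge (Y \<circ> \<gamma>) a b m \<or> (\<exists>t\<in>{a..b}. \<sigma> * Re (\<gamma> t) < - 1/8)"
proof (rule disjCI)
  assume no: "\<not> (\<exists>t\<in>{a..b}. \<sigma> * Re (\<gamma> t) < - 1/8)"
  have "continuous_on {a..b} (\<lambda>t. norm (\<gamma> t))" using assms(1) by (intro continuous_intros)
  from crossing_interval[OF this assms(2-5)] obtain a' b' where
    ab': "a \<le> a'" "a' \<le> b'" "b' \<le> b" "norm (\<gamma> a') = r" "norm (\<gamma> b') = s"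
    "\<And>t. t \<in> {a'..b'} \<Longrightarrow> r \<le> norm (\<gamma> t) \<and> norm (\<gamma> t) \<le> s" by blast
  have "\<gamma> ` {a'..b'} \<subseteq> wall \<sigma> r s" using ab' no by (force simp: wall_def not_less)
  moreover have "continuous_on {a'..b'} \<gamma>" using assms(1) ab' by (auto intro: continuous_on_subset)
  ultimately have len: "polygonal_length_ge (Y \<circ> \<gamma>) a' b' (C * dist (\<gamma> a') (\<gamma> b'))"
    using assms(6) ab'(2) unfolding expands_curves_def by blast
  have "s - r \<le> dist (\<gamma> a') (\<gamma> b')"
    using norm_triangle_ineq2[of "\<gamma> b'" "\<gamma> a'"] ab' by (simp add: dist_norm norm_minus_commute)
  then have "m \<le> C * dist (\<gamma> a') (\<gamma> b')"
    using assms(7,8) by (meson mult_left_mono order_trans)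
  then show "polygonal_length_ge (Y \<circ> \<gamma>) a b m"
    using ab' by (intro polygonal_length_ge_mono[OF len]) auto
qed

text \<open>
  The gaps of the two walls lie on opposite sides of the imaginary axis: a curve either runs through a
  wall, where \<open>Y\<close> stretches enormously, or travels from one gap to the other, a distance of at least 1/4.
\<close>
lemma wall_pair_crossing:
  fixes \<gamma> :: "real \<Rightarrow> complex"
  assumes "continuous_on {a..b} \<gamma>" "a \<le> b" "norm (\<gamma> a) \<le> x" "y \<le> norm (\<gamma> b)"
    and ord: "x \<le> r1" "r1 \<le> s1" "s1 \<le> r2" "r2 \<le> s2" "s2 \<le> y"
    and V: "expands_curves Y (cball 0 y - ball 0 x) c" "c \<ge> 0"
    and W: "expands_curves Y (wall 1 r1 s1) C" "expands_curves Y (wall (-1) r2 s2) C"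
      "c / 4 \<le> C * (s1 - r1)" "c / 4 \<le> C * (s2 - r2)" "C \<ge> 0"
  shows "polygonal_length_ge (Y \<circ> \<gamma>) a b (c / 4)"
proof -
  have "continuous_on {a..b} (\<lambda>t. norm (\<gamma> t))" using assms(1) by (intro continuous_intros)
  moreover have "x \<le> y" using ord by linarith
  \<comment> \<open>Cutting down to the part inside the annulus ensures that the passage from one
    gap side to the other takes place where \<open>V\<close> applies.\<close>
  ultimately obtain a' b' where
    ab': "a \<le> a'" "a' \<le> b'" "b' \<le> b" "norm (\<gamma> a') = x" "norm (\<gamma> b') = y"
    "\<And>t. t \<in> {a'..b'} \<Longrightarrow> x \<le> norm (\<gamma> t) \<and> norm (\<gamma> t) \<le> y"
    using crossing_interval[of a b "\<lambda>t. norm (\<gamma> t)" x y] assms(2-4) by blast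
  have cont: "continuous_on {a'..b'} \<gamma>" using assms(1) ab' by (auto intro: continuous_on_subset)
  have "polygonal_length_ge (Y \<circ> \<gamma>) a' b' (c / 4)"
  proof (rule ccontr)
    assume neg: "\<not> ?thesis"
    have "\<exists>t\<in>{a'..b'}. 1 * Re (\<gamma> t) < - 1/8" "\<exists>t\<in>{a'..b'}. (-1) * Re (\<gamma> t) < - 1/8"
      using wall_crossing[OF cont ab'(2) _ _ _ W(1,3,5)] wall_crossing[OF cont ab'(2) _ _ _ W(2,4,5)]
        neg ord ab'(4,5) by linarith+
    then obtain t1 t2 where t: "t1 \<in> {a'..b'}" "Re (\<gamma> t1) < - 1/8" "t2 \<in> {a'..b'}" "Re (\<gamma> t2) > 1/8"
      by auto
    have far: "c / 4 \<le> c * dist (\<gamma> t1) (\<gamma> t2)"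
    proof -
      have "1/4 \<le> dist (\<gamma> t1) (\<gamma> t2)"
        using t abs_Re_le_cmod[of "\<gamma> t1 - \<gamma> t2"] by (simp add: dist_norm)
      from mult_left_mono[OF this V(2)] show ?thesis by simp
    qed
    \<comment> \<open>Stated for any ordered pair of times, since either half-plane may be visited
      first.\<close>
    have *: "polygonal_length_ge (Y \<circ> \<gamma>) a' b' (c / 4)"
      if "p \<le> q" "p \<in> {a'..b'}" "q \<in> {a'..b'}" "c / 4 \<le> c * dist (\<gamma> p) (\<gamma> q)" for p q
    proof -
      have "\<gamma> ` {p..q} \<subseteq> cball 0 y - ball 0 x" using that ab'(6) by (force simp: not_less)
      moreover have "continuous_on {p..q} \<gamma>" using cont that by (auto intro: continuous_on_subset)
      ultimately have "polygonal_length_ge (Y \<circ> \<gamma>) p q (c * dist (\<gamma> p) (\<gamma> q))"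
        using V(1) that(1) unfolding expands_curves_def by blast
      then show ?thesis by (rule polygonal_length_ge_mono) (use that in auto)
    qed
    show False
    proof (cases "t1 \<le> t2")
      case True
      from *[OF True t(1,3) far] neg show ?thesis by contradiction
    next
      case False
      then have "t2 \<le> t1" by simp
      from *[OF this t(3,1)] far neg show ?thesis by (simp add: dist_commute)
    qed
  qed
  then show ?thesis by (rule polygonal_length_ge_mono) (use ab' in auto)
qed

text \<open>Cut the curve at a time when its modulus equals \<open>x n\<close>. The hypothesis
  \<open>step\<close> covers all subintervals, with inequalities at their ends, so it applies to the
  pieces without further trimming.\<close>

lemma polygonal_length_ge_crossings:
  fixes \<gamma> :: "real \<Rightarrow> complex" and x :: "nat \<Rightarrow> real"
  assumes "continuous_on {a..b} \<gamma>" "a \<le> b" "norm (\<gamma> a) \<le> x 0" "x n \<le> norm (\<gamma> b)" "incseq x"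
    and step: "\<And>k a' b'. k < n \<Longrightarrow> a \<le> a' \<Longrightarrow> a' \<le> b' \<Longrightarrow> b' \<le> b \<Longrightarrow> norm (\<gamma> a') \<le> x k \<Longrightarrow>
      x (Suc k) \<le> norm (\<gamma> b') \<Longrightarrow> polygonal_length_ge c a' b' m"
  shows "polygonal_length_ge c a b (n * m)"
  using assms
proof (induction n arbitrary: b)
  case 0
  then show ?case unfolding polygonal_length_ge_def
    by (intro exI[of _ 0] exI[of _ "\<lambda>_. a"]) auto
next
  case (Suc n)
  have "continuous_on {a..b} (\<lambda>t. norm (\<gamma> t))" using Suc.prems(1) by (intro continuous_intros)
  moreover have "x 0 \<le> x n" "x n \<le> x (Suc n)" using Suc.prems(5) by (auto simp: incseq_def)
  ultimately obtain d where d: "a \<le> d" "d \<le> b" "norm (\<gamma> d) = x n"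
    using IVT'[of "\<lambda>t. norm (\<gamma> t)" a "x n" b] Suc.prems(2-4) by auto
  have "continuous_on {a..d} \<gamma>" using Suc.prems(1) d by (auto intro: continuous_on_subset)
  then have "polygonal_length_ge c a d (n * m)"
  proof (rule Suc.IH)
    fix k a' b' assume "k < n" "a \<le> a'" "a' \<le> b'" "b' \<le> d" "norm (\<gamma> a') \<le> x k" "x (Suc k) \<le> norm (\<gamma> b')"
    then show "polygonal_length_ge c a' b' m" using d(2) by (intro Suc.prems(6)[of k]) simp_all
  qed (use Suc.prems(3,5) d in simp_all)
  moreover have "polygonal_length_ge c d b m"
    using Suc.prems(4) d by (intro Suc.prems(6)[of n]) simp_all
  ultimately have "polygonal_length_ge c a b (n * m + m)"
    using d by (intro polygonal_length_ge_add)
  then show ?case by (simp add: algebra_simps)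
qed

lemma expands_curves_subset: "expands_curves Y K l \<Longrightarrow> K' \<subseteq> K \<Longrightarrow> expands_curves Y K' l"
  unfolding expands_curves_def by (meson order_trans)

section \<open>Minimal immersions from null curves\<close>

text \<open>Summed over the entries of a null vector, the terms
  \<open>Re (v\<^sup>2 * p\<^sup>2)\<close> cancel; what remains depends on \<open>v\<close> only
  through \<open>norm v\<close>, which is conformality.\<close>

lemma Re_mult_squared: "(Re (p * v))\<^sup>2 = (norm p ^ 2 * norm v ^ 2 + Re (v\<^sup>2 * p\<^sup>2)) / 2"
proof -
  have "(Re w)\<^sup>2 = (norm w ^ 2 + Re (w\<^sup>2)) / 2" for w :: complex
    by (simp add: cmod_power2 Re_power2)
  from this[of "p * v"] show ?thesis
    by (simp add: norm_mult power_mult_distrib mult.commute)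
qed

text \<open>The speed formula carries the proof: the differential stretches all directions by one
  positive factor, so it is injective, and the images of \<open>1\<close> and \<open>\<i>\<close>
  have equal length.\<close>

lemma null_curve_immersion:
  fixes F :: "3 \<Rightarrow> complex \<Rightarrow> complex"
  defines "Y \<equiv> \<lambda>z. \<chi> i. Re (F i z)"
  assumes S: "open S" and F: "\<And>i. F i holomorphic_on S"
    and null: "\<And>z. z \<in> S \<Longrightarrow> (\<Sum>i\<in>UNIV. (deriv (F i) z)\<^sup>2) = 0"
    and ne: "\<And>z. z \<in> S \<Longrightarrow> \<exists>i. deriv (F i) z \<noteq> 0"
  shows "conformal_minimal_immersion_on S Y"
    and "\<And>z v. z \<in> S \<Longrightarrow> norm (Re v *\<^sub>R pdx Y z + Im v *\<^sub>R pdy Y z)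
           = sqrt ((\<Sum>i\<in>UNIV. norm (deriv (F i) z) ^ 2) / 2) * norm v"
proof -
  have der: "(Y has_derivative (\<lambda>v. \<chi> i. Re (deriv (F i) z * v))) (at z)" if z: "z \<in> S" for z
  proof -
    have "((\<lambda>x. Y x \<bullet> e) has_derivative (\<lambda>v. (\<chi> i. Re (deriv (F i) z * v)) \<bullet> e)) (at z)"
      if "e \<in> Basis" for e
    proof -
      obtain i where e: "e = axis i 1" using \<open>e \<in> Basis\<close> by (auto simp: Basis_vec_def)
      have "(F i has_field_derivative deriv (F i) z) (at z)"
        using F S z holomorphic_derivI by blast
      from has_derivative_Re_field[OF S z refl this] show ?thesis
        by (simp add: e inner_axis Y_def)
    qed
    then show ?thesis using has_derivative_componentwise_within[of Y _ z UNIV] by simp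
  qed
  have px: "pdx Y z = (\<chi> i. Re (deriv (F i) z))" and py: "pdy Y z = (\<chi> i. Re (deriv (F i) z * \<i>))"
    if "z \<in> S" for z
    using pd_eqI[OF der[OF that]] by simp_all
  have diff: "Y differentiable at z" if "z \<in> S" for z
    using pd_eqI(1)[OF der[OF that]] .
  have D: "(\<chi> i. Re (deriv (F i) z * v)) = Re v *\<^sub>R pdx Y z + Im v *\<^sub>R pdy Y z" if "z \<in> S" for z v
    by (simp add: px[OF that] py[OF that] vec_eq_iff)
  show speed: "norm (Re v *\<^sub>R pdx Y z + Im v *\<^sub>R pdy Y z)
           = sqrt ((\<Sum>i\<in>UNIV. norm (deriv (F i) z) ^ 2) / 2) * norm v" if z: "z \<in> S" for z v
  proof -
    have "(\<Sum>i\<in>UNIV. (Re (deriv (F i) z * v))\<^sup>2)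
        = ((\<Sum>i\<in>UNIV. norm (deriv (F i) z) ^ 2) * norm v ^ 2 + Re (v\<^sup>2 * (\<Sum>i\<in>UNIV. (deriv (F i) z)\<^sup>2))) / 2"
      unfolding Re_mult_squared
      by (simp add: sum.distrib sum_distrib_left sum_distrib_right sum_divide_distrib add_divide_distrib)
    also have "\<dots> = (\<Sum>i\<in>UNIV. norm (deriv (F i) z) ^ 2) / 2 * norm v ^ 2"
      by (simp add: null[OF z])
    finally have eq: "(\<Sum>i\<in>UNIV. (Re (deriv (F i) z * v))\<^sup>2)
        = (\<Sum>i\<in>UNIV. norm (deriv (F i) z) ^ 2) / 2 * norm v ^ 2" .
    have "norm (Re v *\<^sub>R pdx Y z + Im v *\<^sub>R pdy Y z) = sqrt (\<Sum>i\<in>UNIV. (Re (deriv (F i) z * v))\<^sup>2)"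
      unfolding D[OF z, symmetric] by (simp add: norm_vec_def L2_set_def)
    also have "\<dots> = sqrt ((\<Sum>i\<in>UNIV. norm (deriv (F i) z) ^ 2) / 2) * norm v"
      unfolding eq by (subst real_sqrt_mult) simp
    finally show ?thesis .
  qed
  have pos: "sqrt ((\<Sum>i\<in>UNIV. norm (deriv (F i) z) ^ 2) / 2) > 0" if z: "z \<in> S" for z
  proof -
    obtain i where "deriv (F i) z \<noteq> 0" using ne[OF z] by blast
    then have "0 < (\<Sum>i\<in>UNIV. norm (deriv (F i) z) ^ 2)"
      by (intro sum_pos2[of _ i]) auto
    then show ?thesis by simp
  qed
  have inj: "inj (frechet_derivative Y (at z))" if z: "z \<in> S" for z
  proof -
    have fd: "frechet_derivative Y (at z) = (\<lambda>v. Re v *\<^sub>R pdx Y z + Im v *\<^sub>R pdy Y z)"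
      using frechet_derivative_at[OF has_derivative_pd[OF diff[OF z]]] by simp
    have "v = w" if "Re v *\<^sub>R pdx Y z + Im v *\<^sub>R pdy Y z = Re w *\<^sub>R pdx Y z + Im w *\<^sub>R pdy Y z" for v w
    proof -
      have "norm (Re (v - w) *\<^sub>R pdx Y z + Im (v - w) *\<^sub>R pdy Y z) = 0"
        using that by (simp add: algebra_simps)
      then show ?thesis using speed[OF z, of "v - w"] pos[OF z] by simp
    qed
    then show ?thesis unfolding fd by (auto intro: injI)
  qed
  have conf: "pdx Y z \<bullet> pdy Y z = 0 \<and> norm (pdx Y z) = norm (pdy Y z)" if z: "z \<in> S" for z
  proof
    \<comment> \<open>The imaginary part of the null condition is -2 times the inner product of the
      two partials.\<close>
    have "Im (\<Sum>i\<in>UNIV. (deriv (F i) z)\<^sup>2) = 0" using null[OF z] by simp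
    then have "(\<Sum>i\<in>UNIV. 2 * (Re (deriv (F i) z) * Im (deriv (F i) z))) = 0"
      by (simp add: Im_power2 mult.assoc)
    then show "pdx Y z \<bullet> pdy Y z = 0"
      by (simp add: px[OF z] py[OF z] inner_vec_def sum_negf sum_distrib_left[symmetric])
    show "norm (pdx Y z) = norm (pdy Y z)" using speed[OF z, of 1] speed[OF z, of \<i>] by simp
  qed
  have dF: "continuous_on S (deriv (F i))" for i
    using holomorphic_deriv[OF F S] by (rule holomorphic_on_imp_continuous_on)
  have "continuous_on S (\<lambda>z. \<chi> i. Re (deriv (F i) z))" "continuous_on S (\<lambda>z. \<chi> i. Re (deriv (F i) z * \<i>))"
    by (intro continuous_intros dF)+
  then have "continuous_on S (pdx Y)" "continuous_on S (pdy Y)"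
    by (auto simp: px py cong: continuous_on_cong)
  then have "conformal_immersion_on S Y"
    unfolding conformal_immersion_on_def using S diff inj conf by auto
  moreover have "harmonic_on S (\<lambda>z. Y z $ i)" for i
    by (rule harmonic_on_Re[OF S F[of i]]) (simp add: Y_def)
  ultimately show "conformal_minimal_immersion_on S Y"
    by (simp add: conformal_minimal_immersion_on_def)
qed

text \<open>
  The function \<open>B = exp H\<close> has no zeros, so \<open>A\<close> and \<open>B\<close> have no common zeros whatever the zeros
  of \<open>deriv h\<close>, and the resulting surface has no branch points.
\<close>
lemma weierstrass_immersion:
  assumes S: "convex S" "open S" and h: "h holomorphic_on S" and H: "H holomorphic_on S"
  obtains Y :: "complex \<Rightarrow> real^3" where "conformal_minimal_immersion_on S Y"
    "\<And>z. Y z $ 3 = Re (h z)"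
    "\<And>K l. compact K \<Longrightarrow> K \<subseteq> S \<Longrightarrow> l > 0 \<Longrightarrow>
       (\<And>z. z \<in> K \<Longrightarrow> l \<le> norm (deriv h z) \<or> l \<le> exp (Re (H z)) / 2) \<Longrightarrow> expands_curves Y K (l / 2)"
proof -
  define A where "A z = (deriv h z)\<^sup>2 * exp (- H z)" for z
  define B where "B z = exp (H z)" for z
  have hol: "A holomorphic_on S" "B holomorphic_on S"
    unfolding A_def B_def using holomorphic_deriv[OF h S(2)] H by (auto intro!: holomorphic_intros)
  have AB: "A z * B z = (deriv h z)\<^sup>2" for z
    by (simp add: A_def B_def exp_minus)
  have hol': "(\<lambda>z. (A z - B z) / 2) holomorphic_on S" "(\<lambda>z. \<i> * (A z + B z) / 2) holomorphic_on S"
    using hol by (auto intro!: holomorphic_intros)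
  obtain F1 where F1: "\<And>z. z \<in> S \<Longrightarrow> (F1 has_field_derivative (A z - B z) / 2) (at z within S)"
    using holomorphic_convex_primitive'[OF S hol'(1)] by blast
  obtain F2 where F2: "\<And>z. z \<in> S \<Longrightarrow> (F2 has_field_derivative \<i> * (A z + B z) / 2) (at z within S)"
    using holomorphic_convex_primitive'[OF S hol'(2)] by blast
  define F where "F i = (if i = 1 then F1 else if i = 2 then F2 else h)" for i :: 3
  have F_simps: "F 1 = F1" "F 2 = F2" "F 3 = h" by (auto simp: F_def)
  have d1: "deriv F1 z = (A z - B z) / 2" and d2: "deriv F2 z = \<i> * (A z + B z) / 2" if "z \<in> S" for z
    using F1[OF that] F2[OF that] at_within_open[OF that S(2)] DERIV_imp_deriv by metis+
  have "F1 holomorphic_on S" "F2 holomorphic_on S"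
    using F1 F2 by (auto simp: holomorphic_on_def field_differentiable_def)
  then have F: "F i holomorphic_on S" for i using h by (auto simp: F_def)
  have null: "(\<Sum>i\<in>UNIV. (deriv (F i) z)\<^sup>2) = 0" if "z \<in> S" for z
  proof -
    \<comment> \<open>The two squares sum to \<open>- (A z * B z)\<close>, and
      \<open>A z * B z\<close> is the square of the prescribed third entry.\<close>
    have "((A z - B z) / 2)\<^sup>2 + (\<i> * (A z + B z) / 2)\<^sup>2 = - (A z * B z)"
      by (simp add: power_divide power_mult_distrib power2_eq_square field_simps)
    then show ?thesis by (simp add: sum_3 F_simps d1[OF that] d2[OF that] AB)
  qed
  \<comment> \<open>This combination isolates the zero-free factor; it yields both the immersion
    property and the lower bound by \<open>exp (Re (H z)) / 2\<close>.\<close>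
  have B': "deriv F1 z + \<i> * deriv F2 z = - B z" if "z \<in> S" for z
    by (simp add: d1[OF that] d2[OF that] field_simps)
  have ne: "\<exists>i. deriv (F i) z \<noteq> 0" if "z \<in> S" for z
  proof (rule ccontr)
    assume "\<nexists>i. deriv (F i) z \<noteq> 0"
    then have "deriv F1 z = 0" "deriv F2 z = 0" using F_simps by metis+
    with B'[OF that] show False by (simp add: B_def)
  qed
  define Y :: "complex \<Rightarrow> real^3" where "Y z = (\<chi> i. Re (F i z))" for z
  have Yeq: "Y = (\<lambda>z. \<chi> i. Re (F i z))" by (rule ext) (rule Y_def)
  note imm = null_curve_immersion[OF S(2) F null ne, folded Yeq]
  \<comment> \<open>With \<open>a\<close>, \<open>b\<close>, \<open>c\<close> as below, nullity
    gives \<open>c\<^sup>2 \<le> a\<^sup>2 + b\<^sup>2\<close>, so half of the total is at least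
    \<open>c\<^sup>2\<close>. The other alternative rests on
    \<open>exp (Re (H z)) \<le> a + b\<close> and
    \<open>(a + b)\<^sup>2 \<le> 2 * (a\<^sup>2 + b\<^sup>2)\<close>.\<close>
  have lower: "l \<le> sqrt ((\<Sum>i\<in>UNIV. norm (deriv (F i) z) ^ 2) / 2)"
    if z: "z \<in> S" and "l > 0" and l: "l \<le> norm (deriv h z) \<or> l \<le> exp (Re (H z)) / 2" for z l
  proof (rule real_le_rsqrt)
    define a b c where "a = norm (deriv F1 z)" and "b = norm (deriv F2 z)" and "c = norm (deriv h z)"
    have sum: "(\<Sum>i\<in>UNIV. norm (deriv (F i) z) ^ 2) = a\<^sup>2 + b\<^sup>2 + c\<^sup>2"
      by (simp add: sum_3 F_simps a_def b_def c_def)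
    have "(deriv F1 z)\<^sup>2 + (deriv F2 z)\<^sup>2 + (deriv h z)\<^sup>2 = 0"
      using null[OF z] by (simp add: sum_3 F_simps)
    then have "(deriv F1 z)\<^sup>2 + (deriv F2 z)\<^sup>2 = - ((deriv h z)\<^sup>2)"
      by (simp add: eq_neg_iff_add_eq_0)
    then have "norm ((deriv h z)\<^sup>2) = norm ((deriv F1 z)\<^sup>2 + (deriv F2 z)\<^sup>2)" by simp
    also have "\<dots> \<le> norm ((deriv F1 z)\<^sup>2) + norm ((deriv F2 z)\<^sup>2)" by (rule norm_triangle_ineq)
    finally have c: "c\<^sup>2 \<le> a\<^sup>2 + b\<^sup>2" by (simp add: a_def b_def c_def norm_power)
    have e: "exp (Re (H z)) \<le> a + b"
    proof -
      have "exp (Re (H z)) = norm (deriv F1 z + \<i> * deriv F2 z)" using B'[OF z] by (simp add: B_def)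
      then show ?thesis
        using norm_triangle_ineq[of "deriv F1 z" "\<i> * deriv F2 z"] by (simp add: norm_mult a_def b_def)
    qed
    from l show "l\<^sup>2 \<le> (\<Sum>i\<in>UNIV. norm (deriv (F i) z) ^ 2) / 2"
      unfolding sum
    proof
      assume "l \<le> norm (deriv h z)"
      then have "l\<^sup>2 \<le> c\<^sup>2" using \<open>l > 0\<close> by (simp add: c_def power_mono)
      then show "l\<^sup>2 \<le> (a\<^sup>2 + b\<^sup>2 + c\<^sup>2) / 2" using c by simp
    next
      assume "l \<le> exp (Re (H z)) / 2"
      then have "2 * l \<le> a + b" using e by simp
      then have "(2 * l)\<^sup>2 \<le> (a + b)\<^sup>2" using \<open>l > 0\<close> by (intro power_mono) auto
      also have "\<dots> \<le> 2 * (a\<^sup>2 + b\<^sup>2)"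
        using zero_le_power2[of "a - b"] by (simp add: power2_eq_square algebra_simps)
      finally have "2 * l\<^sup>2 \<le> a\<^sup>2 + b\<^sup>2" by (simp add: power_mult_distrib)
      also have "\<dots> \<le> a\<^sup>2 + b\<^sup>2 + c\<^sup>2" by simp
      finally show "l\<^sup>2 \<le> (a\<^sup>2 + b\<^sup>2 + c\<^sup>2) / 2" by simp
    qed
  qed
  show thesis
  proof (rule that[of Y])
    show "conformal_minimal_immersion_on S Y" by (rule imm(1))
    show "Y z $ 3 = Re (h z)" for z by (simp add: Y_def F_simps)
    fix K l assume K: "compact K" "K \<subseteq> S" and l: "l > 0"
      "\<And>z. z \<in> K \<Longrightarrow> l \<le> norm (deriv h z) \<or> l \<le> exp (Re (H z)) / 2"
    have ci: "conformal_immersion_on S Y" using imm(1) by (simp add: conformal_minimal_immersion_on_def)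
    show "expands_curves Y K (l / 2)"
    proof (rule expands_curves_C1[OF S(2) K])
      fix z v assume z: "z \<in> K"
      then have "l \<le> sqrt ((\<Sum>i\<in>UNIV. norm (deriv (F i) z) ^ 2) / 2)" using lower l K by blast
      then show "l * norm v \<le> norm (Re v *\<^sub>R pdx Y z + Im v *\<^sub>R pdy Y z)"
        using imm(2)[of z v] z K by (simp add: mult_right_mono subset_iff)
    qed (use ci l in \<open>auto simp: conformal_immersion_on_def\<close>)
  qed
qed

section \<open>Completeness\<close>

text \<open>Zeros may accumulate at the unit circle, but only finitely many lie in a smaller closed
  disc, so some interval of radii between \<open>r\<close> and \<open>q\<close> avoids their
  moduli.\<close>

lemma zero_free_annulus:
  assumes f: "f holomorphic_on ball 0 1" and ne: "\<exists>z\<in>ball 0 1. f z \<noteq> 0" and r: "r < 1"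
  shows "\<exists>s t. r < s \<and> s < t \<and> t < 1 \<and> (\<forall>z. s \<le> norm z \<and> norm z \<le> t \<longrightarrow> f z \<noteq> 0)"
proof -
  define q where "q = (1 + r) / 2"
  have q: "r < q" "q < 1" using r by (auto simp: q_def field_simps)
  have fin: "finite {z\<in>cball 0 q. f z = 0}"
  proof (cases "f constant_on ball 0 1")
    case True
    \<comment> \<open>Finiteness of the zeros on compact sets concerns non-constant functions; a
      constant one is non-zero by \<open>ne\<close>.\<close>
    then obtain c where c: "\<And>z. z \<in> ball 0 1 \<Longrightarrow> f z = c" by (auto simp: constant_on_def)
    then have "c \<noteq> 0" using ne by auto
    then have "{z\<in>cball 0 q. f z = 0} = {}" using c q by auto
    then show ?thesis by (metis finite.emptyI)
  next
    case False
    then show ?thesis using q by (intro holomorphic_compact_finite_zeros[OF f]) auto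
  qed
  define Z where "Z = norm ` {z\<in>cball 0 q. f z = 0}"
  have Z: "finite Z" using fin by (simp add: Z_def)
  have "infinite ({r<..<q} - Z)" using q Z by (simp add: Diff_infinite_finite)
  then obtain x where x: "x \<in> {r<..<q} - Z" by (metis all_not_in_conv finite.emptyI)
  have "open ({r<..<q} - Z)" using Z by (intro open_Diff finite_imp_closed) auto
  then obtain e where e: "e > 0" "ball x e \<subseteq> {r<..<q} - Z" using x openE by blast
  have in_e: "y \<in> {r<..<q} - Z" if "x \<le> y" "y \<le> x + e/2" for y
    using e that by (intro subsetD[OF e(2)]) (simp add: dist_real_def)
  show ?thesis
  proof (rule exI[of _ x], rule exI[of _ "x + e/2"], intro conjI allI impI)
    show "x + e/2 < 1" using in_e[of "x + e/2"] q e by auto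
    fix z :: complex assume "x \<le> norm z \<and> norm z \<le> x + e/2"
    then have "norm z \<in> {r<..<q} - Z" using in_e by blast
    then show "f z \<noteq> 0" by (auto simp: Z_def)
  qed (use x e in auto)
qed

text \<open>A pair takes up radial width \<open>4 * d\<close>: free, wall, free, wall, each of width
  \<open>d\<close>. Running through a wall yields \<open>d * (c / (8 * d)) = c / 8\<close>, and
  travelling between the gaps \<open>(c / 2) / 4 = c / 8\<close>, so the gain does not depend on
  \<open>d\<close>.\<close>

lemma labyrinth_stage_crossing:
  fixes \<gamma> :: "real \<Rightarrow> complex"
  assumes "continuous_on {a..b} \<gamma>" "a \<le> b" "norm (\<gamma> a) \<le> s" "t \<le> norm (\<gamma> b)"
    and d: "d > 0" "t = s + 4 * real N * d" and "c > 0"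
    and V: "expands_curves Y (cball 0 t - ball 0 s) (c / 2)"
    and W: "\<And>j. j < 2 * N \<Longrightarrow> expands_curves Y
        (wall ((-1)^j) (s + (2 * real j + 1) * d) (s + (2 * real j + 2) * d)) (c / (8 * d))"
  shows "polygonal_length_ge (Y \<circ> \<gamma>) a b (N * (c / 8))"
proof (rule polygonal_length_ge_crossings[where x = "\<lambda>k. s + 4 * real k * d", OF assms(1,2)])
  show "incseq (\<lambda>k. s + 4 * real k * d)" using d by (simp add: incseq_def)
  fix k a' b' assume k: "k < N" and ab': "a \<le> a'" "a' \<le> b'" "b' \<le> b"
    "norm (\<gamma> a') \<le> s + 4 * real k * d" "s + 4 * real (Suc k) * d \<le> norm (\<gamma> b')"
  have cont: "continuous_on {a'..b'} \<gamma>" using assms(1) ab' by (auto intro: continuous_on_subset)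
  have "(4 * d) * real (Suc k) \<le> (4 * d) * real N" using k d by (intro mult_left_mono) auto
  then have le: "s + 4 * real (Suc k) * d \<le> t" using d by (simp add: algebra_simps)
  have V': "expands_curves Y (cball 0 (s + 4 * real (Suc k) * d) - ball 0 (s + 4 * real k * d)) (c / 2)"
  proof (rule expands_curves_subset[OF V])
    have "s \<le> s + 4 * real k * d" using d by simp
    then show "cball 0 (s + 4 * real (Suc k) * d) - ball 0 (s + 4 * real k * d) \<subseteq> cball 0 t - ball 0 s"
      using le by (intro Diff_mono subset_cball subset_ball)
  qed
  have W1: "expands_curves Y (wall 1 (s + (4 * real k + 1) * d) (s + (4 * real k + 2) * d)) (c / (8 * d))"
    using W[of "2 * k"] k by simp
  have W2: "expands_curves Y (wall (-1) (s + (4 * real k + 3) * d) (s + (4 * real k + 4) * d)) (c / (8 * d))"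
    using W[of "Suc (2 * k)"] k by (simp add: algebra_simps)
  have "polygonal_length_ge (Y \<circ> \<gamma>) a' b' (c / 2 / 4)"
    by (rule wall_pair_crossing[OF cont ab'(2,4,5) _ _ _ _ _ V' _ W1 W2])
      (use d \<open>c > 0\<close> in \<open>auto simp: field_simps\<close>)
  then show "polygonal_length_ge (Y \<circ> \<gamma>) a' b' (c / 8)" by simp
qed (use assms(3,4) d in auto)

section \<open>From crossings to completeness\<close>

lemma complete_immersion_plane:
  fixes Y :: "complex \<Rightarrow> real^3"
  assumes "l > 0" "\<And>K. compact K \<Longrightarrow> expands_curves Y K l"
  shows "complete_immersion_on UNIV Y"
  unfolding complete_immersion_on_def
proof (intro allI impI curve_length_infinite)
  fix \<gamma> and N :: nat assume "divergent_curve UNIV \<gamma>"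
  then have cont: "continuous_on {0..<1} \<gamma>"
    and div: "\<And>K. compact K \<Longrightarrow> \<exists>t0\<in>{0..<1}. \<forall>t\<in>{t0..<1}. \<gamma> t \<notin> K"
    by (auto simp: divergent_curve_def)
  obtain b where b: "b \<in> {0..<1}" "\<gamma> b \<notin> cball (\<gamma> 0) (N / l)"
    using div[OF compact_cball[of "\<gamma> 0" "N / l"]] by force
  have c: "continuous_on {0..b} \<gamma>" using cont b by (auto intro: continuous_on_subset)
  \<comment> \<open>The trace of the initial arc is itself the compact set to which the expansion is
    applied.\<close>
  then have "compact (\<gamma> ` {0..b})" by (rule compact_continuous_image) simp
  then have "polygonal_length_ge (Y \<circ> \<gamma>) 0 b (l * dist (\<gamma> 0) (\<gamma> b))"
    using assms(2) c b unfolding expands_curves_def by auto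
  then have "polygonal_length_ge (Y \<circ> \<gamma>) 0 b N"
    by (rule polygonal_length_ge_mono) (use b assms(1) in \<open>auto simp: field_simps\<close>)
  moreover have "{0..b} \<subseteq> {0..<1}" using b by auto
  ultimately show "\<exists>a b. {a..b} \<subseteq> {0..<1} \<and> polygonal_length_ge (Y \<circ> \<gamma>) a b N" by auto
qed

text \<open>A divergent curve starts inside some radius \<open>s n\<close> and leaves the disc of
  radius \<open>s (n + N)\<close>, so it crosses \<open>N\<close> stages of length at least
  1.\<close>

lemma complete_immersion_disc:
  fixes Y :: "complex \<Rightarrow> real^3" and s :: "nat \<Rightarrow> real"
  assumes s: "incseq s" "\<And>n. s n < 1" "s \<longlonglongrightarrow> 1"
    and stage: "\<And>n \<gamma> a b. continuous_on {a..b} \<gamma> \<Longrightarrow> a \<le> b \<Longrightarrow> norm (\<gamma> a) \<le> s n \<Longrightarrow>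
      s (Suc n) \<le> norm (\<gamma> b) \<Longrightarrow> polygonal_length_ge (Y \<circ> \<gamma>) a b 1"
  shows "complete_immersion_on (ball 0 1) Y"
  unfolding complete_immersion_on_def
proof (intro allI impI curve_length_infinite)
  fix \<gamma> and N :: nat assume "divergent_curve (ball 0 1) \<gamma>"
  then have cont: "continuous_on {0..<1} \<gamma>" and im: "\<gamma> ` {0..<1} \<subseteq> ball 0 1"
    and div: "\<And>K. compact K \<Longrightarrow> K \<subseteq> ball 0 1 \<Longrightarrow> \<exists>t0\<in>{0..<1}. \<forall>t\<in>{t0..<1}. \<gamma> t \<notin> K"
    by (auto simp: divergent_curve_def)
  have "norm (\<gamma> 0) < 1" using im by (auto simp: image_subset_iff)
  then obtain n where n: "norm (\<gamma> 0) < s n"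
    using order_tendstoD(1)[OF s(3)] unfolding eventually_sequentially by blast
  have "cball 0 (s (n + N)) \<subseteq> ball (0::complex) 1" using s(2)[of "n + N"] by auto
  from div[OF compact_cball this]
  obtain b where b: "b \<in> {0..<1}" "\<gamma> b \<notin> cball 0 (s (n + N))" by force
  have c: "continuous_on {0..b} \<gamma>" using cont b by (auto intro: continuous_on_subset)
  have "polygonal_length_ge (Y \<circ> \<gamma>) 0 b (real N * 1)"
  proof (rule polygonal_length_ge_crossings[where x = "\<lambda>k. s (n + k)", OF c])
    show "incseq (\<lambda>k. s (n + k))" using s(1) by (simp add: incseq_def)
    fix k a' b' assume "0 \<le> a'" "a' \<le> b'" "b' \<le> b" "norm (\<gamma> a') \<le> s (n + k)" "s (n + Suc k) \<le> norm (\<gamma> b')"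
    then show "polygonal_length_ge (Y \<circ> \<gamma>) a' b' 1"
      by (intro stage[of _ _ _ "n + k"]) (auto intro: continuous_on_subset[OF c])
  qed (use n b in auto)
  moreover have "{0..b} \<subseteq> {0..<1}" using b by auto
  ultimately show "\<exists>a b. {a..b} \<subseteq> {0..<1} \<and> polygonal_length_ge (Y \<circ> \<gamma>) a b N" by auto
qed

section \<open>Construction of the labyrinth\<close>

lemma labyrinth_stages:
  assumes f: "f holomorphic_on ball 0 1" and ne: "\<exists>z\<in>ball 0 1. f z \<noteq> 0"
  obtains s t c :: "nat \<Rightarrow> real" where "\<And>n. 1/2 \<le> s n" "\<And>n. s n < t n" "\<And>n. t n \<le> s (Suc n)"
    "\<And>n. s n < 1" "s \<longlonglongrightarrow> 1" "\<And>n. c n > 0"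
    "\<And>n z. s n \<le> norm z \<Longrightarrow> norm z \<le> t n \<Longrightarrow> c n \<le> norm (f z)"
proof -
  \<comment> \<open>The bound 1/2 keeps all radii above the offset 1/8 of the gaps, and
    \<open>1 - inverse (real (Suc n))\<close> drives the stages to the unit circle.\<close>
  let ?P = "\<lambda>n p. 1/2 \<le> fst p \<and> 1 - inverse (real (Suc n)) \<le> fst p \<and> fst p < snd p \<and> snd p < 1 \<and>
      (\<forall>z. fst p \<le> norm z \<and> norm z \<le> snd p \<longrightarrow> f z \<noteq> 0)"
  have ex: "\<exists>p::real\<times>real. ?P n p \<and> r \<le> fst p" if "r < 1" for n r
  proof -
    have "max r (max (1/2) (1 - inverse (real (Suc n)))) < 1" using that by simp
    from zero_free_annulus[OF f ne this] obtain s t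
      where "max r (max (1/2) (1 - inverse (real (Suc n)))) < s" "s < t" "t < 1"
        "\<forall>z. s \<le> norm z \<and> norm z \<le> t \<longrightarrow> f z \<noteq> 0" by blast
    then show ?thesis by (intro exI[of _ "(s, t)"]) auto
  qed
  have "\<exists>p. \<forall>n. ?P n (p n) \<and> snd (p n) \<le> fst (p (Suc n))"
  proof (rule dependent_nat_choice)
    show "\<exists>p. ?P 0 p" using ex[of 0 0] by auto
    fix p n assume "?P n p"
    then show "\<exists>q. ?P (Suc n) q \<and> snd p \<le> fst q" using ex[of "snd p" "Suc n"] by auto
  qed
  then obtain p where p: "\<And>n. ?P n (p n)" "\<And>n. snd (p n) \<le> fst (p (Suc n))" by blast
  have "\<exists>c>0. \<forall>z. fst (p n) \<le> norm z \<and> norm z \<le> snd (p n) \<longrightarrow> c \<le> norm (f z)" for n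
  proof -
    let ?V = "cball 0 (snd (p n)) - ball 0 (fst (p n)) :: complex set"
    have V: "compact ?V" by (intro compact_diff) auto
    have "of_real (fst (p n)) \<in> ?V" using p(1)[of n] by auto
    then have "?V \<noteq> {}" by blast
    have "?V \<subseteq> ball 0 1" using p(1)[of n] by auto
    then have "continuous_on ?V f"
      using holomorphic_on_imp_continuous_on[OF f] continuous_on_subset by blast
    then have "continuous_on ?V (\<lambda>z. norm (f z))" by (intro continuous_intros)
    from continuous_attains_inf[OF V \<open>?V \<noteq> {}\<close> this]
    obtain w where w: "w \<in> ?V" "\<And>z. z \<in> ?V \<Longrightarrow> norm (f w) \<le> norm (f z)" by blast
    have "norm (f w) > 0" using w(1) p(1)[of n] by auto
    then show ?thesis using w(2) by (intro exI[of _ "norm (f w)"]) auto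
  qed
  then obtain c where c: "\<And>n. c n > 0"
    "\<And>n z. fst (p n) \<le> norm z \<and> norm z \<le> snd (p n) \<Longrightarrow> c n \<le> norm (f z)" by metis
  have lim: "(\<lambda>n. fst (p n)) \<longlonglongrightarrow> 1"
  proof (rule tendsto_sandwich)
    show "(\<lambda>n. 1 - inverse (real (Suc n))) \<longlonglongrightarrow> 1"
      using tendsto_diff[OF tendsto_const LIMSEQ_inverse_real_of_nat, of 1] by simp
    show "\<forall>\<^sub>F n in sequentially. 1 - inverse (real (Suc n)) \<le> fst (p n)" using p(1) by simp
    show "\<forall>\<^sub>F n in sequentially. fst (p n) \<le> 1"
      using p(1) by (auto intro!: always_eventually less_imp_le intro: less_trans)
  qed auto
  show thesis
    by (rule that[of "\<lambda>n. fst (p n)" "\<lambda>n. snd (p n)" c]) (use p c lim in \<open>auto intro: less_trans\<close>)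
qed

lemma complete_minimal_disc:
  assumes h: "h holomorphic_on ball 0 1" and ne: "\<exists>z\<in>ball 0 1. deriv h z \<noteq> 0"
  shows "\<exists>Y :: complex \<Rightarrow> real^3. conformal_minimal_immersion_on (ball 0 1) Y \<and>
    complete_immersion_on (ball 0 1) Y \<and> (\<forall>z. Y z $ 3 = Re (h z))"
proof -
  have f: "deriv h holomorphic_on ball 0 1" using h by (intro holomorphic_deriv) auto
  obtain s t c :: "nat \<Rightarrow> real" where st: "\<And>n. 1/2 \<le> s n" "\<And>n. s n < t n" "\<And>n. t n \<le> s (Suc n)"
    "\<And>n. s n < 1" "s \<longlonglongrightarrow> 1" and c: "\<And>n. c n > 0"
    "\<And>n z. s n \<le> norm z \<Longrightarrow> norm z \<le> t n \<Longrightarrow> c n \<le> norm (deriv h z)"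
    using labyrinth_stages[OF f ne] by metis
  \<comment> \<open>A pair of walls contributes \<open>c n / 8\<close>, so this many pairs give the
    stage length at least 1.\<close>
  define N where "N n = nat \<lceil>8 / c n\<rceil>" for n
  have N: "1 \<le> N n * (c n / 8)" for n
  proof -
    have "8 / c n \<le> N n" unfolding N_def by (rule real_nat_ceiling_ge)
    then show ?thesis using c(1)[of n] by (simp add: field_simps)
  qed
  have N0: "N n > 0" for n using N[of n] by (cases "N n") auto
  define d where "d n = (t n - s n) / (4 * N n)" for n
  have d: "d n > 0" "t n = s n + 4 * real (N n) * d n" for n
    using st(2)[of n] N0[of n] by (auto simp: d_def)
  define r where "r n j = s n + (2 * real j + 1) * d n" for n j
  define r' where "r' n j = s n + (2 * real j + 2) * d n" for n j
  define W where "W n = (\<Union>j<2 * N n. wall ((-1)^j) (r n j) (r' n j))" for n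
  have r't: "r' n j \<le> t n" if "j < 2 * N n" for n j
  proof -
    have "real j + 1 \<le> 2 * N n" using that by linarith
    then have "2 * d n * (real j + 1) \<le> 2 * d n * (2 * N n)" using d(1)[of n] by (intro mult_left_mono) auto
    then show ?thesis using d(2)[of n] by (simp add: r'_def algebra_simps)
  qed
  \<comment> \<open>The logarithm makes \<open>exp (Re (H z)) / 2\<close> at least
    \<open>c n / (4 * d n)\<close> on the walls; half of that remains for curves, the
    \<open>c n / (8 * d n)\<close> needed to cross a stage.\<close>
  obtain H where H: "H holomorphic_on ball 0 1" "\<And>n z. z \<in> W n \<Longrightarrow> ln (c n / (2 * d n)) \<le> Re (H z)"
  proof (rule labyrinth_function[of s t W "\<lambda>n. ln (c n / (2 * d n))"])
    show "s n \<le> t n" for n using st(2) less_imp_le by blast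
    show "W n \<subseteq> cball 0 (t n)" for n using r't by (force simp: W_def wall_def)
    fix n and e M :: real assume "e > 0"
    \<comment> \<open>The disc before wall \<open>j\<close> has radius
      \<open>s n + 2 * real j * d n\<close>, which is the outer radius of the preceding wall;
      \<open>2 * real 0\<close> is its instance at \<open>j = 0\<close>.\<close>
    have "\<exists>P. P holomorphic_on UNIV \<and> (\<forall>z. norm z \<le> s n + 2 * real 0 * d n \<longrightarrow> norm (P z) \<le> e) \<and>
      (\<forall>j<2 * N n. \<forall>z\<in>wall ((-1)^j) (r n j) (r' n j). M \<le> Re (P z))"
      by (rule finite_walls_function[where b = "\<lambda>j. s n + 2 * real j * d n"])
        (use d[of n] st(1)[of n] \<open>e > 0\<close> in \<open>auto simp: r_def r'_def algebra_simps minus_one_power_iff\<close>)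
    then show "\<exists>P. P holomorphic_on UNIV \<and> (\<forall>z. norm z \<le> s n \<longrightarrow> norm (P z) \<le> e) \<and> (\<forall>z\<in>W n. M \<le> Re (P z))"
      by (auto simp: W_def)
  qed (use st in auto)
  obtain Y :: "complex \<Rightarrow> real^3" where Y: "conformal_minimal_immersion_on (ball 0 1) Y"
    "\<And>z. Y z $ 3 = Re (h z)"
    and expand: "\<And>K l. compact K \<Longrightarrow> K \<subseteq> ball 0 1 \<Longrightarrow> l > 0 \<Longrightarrow>
       (\<And>z. z \<in> K \<Longrightarrow> l \<le> norm (deriv h z) \<or> l \<le> exp (Re (H z)) / 2) \<Longrightarrow> expands_curves Y K (l / 2)"
    using weierstrass_immersion[OF convex_ball open_ball h H(1)] by metis
  have t1: "t n < 1" for n using st(3)[of n] st(4)[of "Suc n"] by linarith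
  have "complete_immersion_on (ball 0 1) Y"
  proof (rule complete_immersion_disc[of s])
    show "incseq s"
      using st(2,3) by (intro incseq_SucI) (meson less_imp_le order_trans)
    fix n a b and \<gamma> :: "real \<Rightarrow> complex"
    assume \<gamma>: "continuous_on {a..b} \<gamma>" "a \<le> b" "norm (\<gamma> a) \<le> s n" "s (Suc n) \<le> norm (\<gamma> b)"
    have "polygonal_length_ge (Y \<circ> \<gamma>) a b (N n * (c n / 8))"
    proof (rule labyrinth_stage_crossing[OF \<gamma>(1-3) _ d(1) d(2) c(1)])
      show "t n \<le> norm (\<gamma> b)" using \<gamma>(4) st(3)[of n] by linarith
      show "expands_curves Y (cball 0 (t n) - ball 0 (s n)) (c n / 2)"
        using c t1[of n] by (intro expand compact_diff) auto
      fix j assume j: "j < 2 * N n"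
      have "expands_curves Y (wall ((-1)^j) (r n j) (r' n j)) (c n / (4 * d n) / 2)"
      proof (rule expand[OF compact_wall])
        show "wall ((-1)^j) (r n j) (r' n j) \<subseteq> ball 0 1"
          using r't[OF j] t1[of n] by (auto simp: wall_def)
        show pos: "c n / (4 * d n) > 0" using c(1) d(1) by simp
        fix z assume "z \<in> wall ((-1)^j) (r n j) (r' n j)"
        then have "z \<in> W n" using j by (auto simp: W_def)
        from H(2)[OF this] have "exp (ln (c n / (2 * d n))) \<le> exp (Re (H z))" by simp
        then show "c n / (4 * d n) \<le> norm (deriv h z) \<or> c n / (4 * d n) \<le> exp (Re (H z)) / 2"
          using c(1)[of n] d(1)[of n] by simp
      qed
      then show "expands_curves Y (wall ((-1)^j) (s n + (2 * real j + 1) * d n) (s n + (2 * real j + 2) * d n))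
          (c n / (8 * d n))"
        by (simp add: r_def r'_def)
    qed
    then show "polygonal_length_ge (Y \<circ> \<gamma>) a b 1"
      by (rule polygonal_length_ge_mono) (use N in auto)
  qed (use st in auto)
  then show ?thesis using Y by blast
qed

theorem theorem4p1:
  fixes \<Sigma> :: "complex set" and u :: "complex \<Rightarrow> real"
  assumes "\<Sigma> = UNIV \<or> \<Sigma> = ball 0 1"
    and "harmonic_on \<Sigma> u"
    and "\<Sigma> = ball 0 1 \<Longrightarrow> \<not> (\<exists>c. \<forall>z\<in>\<Sigma>. u z = c)"
  shows "\<exists>Y :: complex \<Rightarrow> real^3.
           conformal_minimal_immersion_on \<Sigma> Y \<and> complete_immersion_on \<Sigma> Y \<and>
           (\<forall>z\<in>\<Sigma>. Y z $ 3 = u z)"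
proof -
  have S: "convex \<Sigma>" "open \<Sigma>" using assms(1) by auto
  obtain h where h: "h holomorphic_on \<Sigma>" "\<And>z. z \<in> \<Sigma> \<Longrightarrow> u z = Re (h z)"
    using harmonic_on_eq_Re[OF S(1) assms(2)] by blast
  from assms(1) show ?thesis
  proof
    assume \<Sigma>: "\<Sigma> = UNIV"
    obtain Y :: "complex \<Rightarrow> real^3" where Y: "conformal_minimal_immersion_on \<Sigma> Y"
      "\<And>z. Y z $ 3 = Re (h z)"
      "\<And>K l. compact K \<Longrightarrow> K \<subseteq> \<Sigma> \<Longrightarrow> l > 0 \<Longrightarrow>
         (\<And>z. z \<in> K \<Longrightarrow> l \<le> norm (deriv h z) \<or> l \<le> exp (Re 0) / 2) \<Longrightarrow> expands_curves Y K (l / 2)"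
      using weierstrass_immersion[OF S h(1), of "\<lambda>_. 0"] by auto
    \<comment> \<open>With \<open>H = 0\<close> the conformal factor is at least
      \<open>exp 0 / 2 = 1/2\<close> everywhere, whatever the zeros of \<open>deriv h\<close>; half
      of it remains for curves.\<close>
    have "complete_immersion_on UNIV Y"
      by (rule complete_immersion_plane[of "1/2/2"]) (use Y(3)[of _ "1/2"] \<Sigma> in auto)
    then show ?thesis using Y h \<Sigma> by auto
  next
    assume \<Sigma>: "\<Sigma> = ball 0 1"
    have "\<exists>z\<in>ball 0 1. deriv h z \<noteq> 0"
    proof (rule ccontr)
      assume no: "\<not> (\<exists>z\<in>ball 0 1. deriv h z \<noteq> 0)"
      have "(h has_field_derivative 0) (at z within ball 0 1)" if "z \<in> ball 0 1" for z
        using holomorphic_derivI[of h "ball 0 1" z] h \<Sigma> no that by (auto intro: has_field_derivative_at_within)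
      then obtain k where "\<And>z. z \<in> ball 0 1 \<Longrightarrow> h z = k"
        using has_field_derivative_zero_constant[OF convex_ball, of 0 1 h] by blast
      then show False using assms(3) h(2) \<Sigma> by auto
    qed
    then show ?thesis using complete_minimal_disc[of h] h \<Sigma> by auto
  qed
qed

end
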